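(* Let $\mu\in\mathcal P(\mathbb R^d)$, let $f$ satisfy conditions (a)–(c) below with constants $L,M$, and let $T>0$, $h\ge0$ with $L(T^2+Th)\le\frac1{12}$. Suppose $\tilde\nu_h$ is a stationary distribution of $\tilde{\mathrm P}_{T,h}$ and there exist $c_1\ge1$, $c_2>0$ such that $W_\psi(\rho\tilde{\mathrm P}_{T,h}^k,\tilde\nu_h)\le c_1e^{-c_2k}W_\psi(\rho,\tilde\nu_h)$ for every integer $k\ge1$ and every probability distribution $\rho$. For $1<q<\infty$ define $\delta_1=(q-1)\big(8dMT^2+\frac{3\sqrt d}{2T}\big)$ and $\delta_2=\frac{9q(q-1)}{8T^2}$. Then for every integer \[ k\ge\frac1{c_2}\log\Big(\frac{c_1W_\psi(\mu,\tilde\nu_h)}{4\sqrt{\log 2}}\big(\delta_1+\sqrt{\delta_1^2+16(\log2)\delta_2}\big)\Big) \] it holds that \[ \mathsf R_q(\mu\tilde{\mathrm P}_{T,h}^{k+1}\,\|\,\tilde\nu_h)\le\frac{\delta_1+\delta_2}{q-1}\sqrt{\log2}\,c_1^2e^{-c_2k}\max\{1,W_\psi^2(\mu,\tilde\nu_h)\}. \]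
   Context: Let $f:\mathbb R^d\to\mathbb R$. Conditions: (a) $f$ has its global minimum at $0$ and $f(0)=0$; (b) $f\in C^2$, $\|\nabla^2f(x)\|_{op}\le L$ for all $x$; (c) $f\in C^3$, $\|\nabla^3f(x)\|_{op}\le M$; $\|\cdot\|_{op}$ of a symmetric multilinear form is the sup of its absolute value over unit vectors. For $h>0$ with $T/h\in\mathbb N$ (always assumed), $\tilde q_{T,h}(x,v)=x_N$, $N=T/h$, where $x_0=x,v_0=v$, $x_{j+1}=x_j+hv_j-\frac{h^2}2\nabla f(x_j)$, $v_{j+1}=v_j-\frac h2(\nabla f(x_j)+\nabla f(x_{j+1}))$; for $h=0$, $\tilde q_{T,0}(x,v)$ is the time-$T$ position of the solution of $\dot x=v,\dot v=-\nabla f(x)$ started at $(x,v)$. $\tilde{\mathrm P}_{T,h}$ maps $\rho$ to the law of $\tilde q_{T,h}(X,\xi)$ with $X\sim\rho$, $\xi\sim\mathcal N(0,I_d)$ independent. Orlicz norm: $\|X\|_\psi=\inf\{\lambda>0:\mathbb E[e^{\|X\|^2/\lambda^2}]\le2\}$; Orlicz–Wasserstein distance $W_\psi(\mu,\pi)=\inf\{\|X-Y\|_\psi:(X,Y)\text{ a coupling of }\mu,\pi\}$. Rényi divergence of order $q>1$: $\mathsf R_q(\mu\|\pi)=\frac1{q-1}\log\mathbb E_\pi[(d\mu/d\pi)^q]$ if $\mu\ll\pi$, else $+\infty$. *)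

theory Defs
  imports "HOL-Probability.Probability"
begin

text \<open>G plays the role of the gradient of f.\<close>

definition leapfrog_step :: "('a::euclidean_space \<Rightarrow> 'a) \<Rightarrow> real \<Rightarrow> 'a \<times> 'a \<Rightarrow> 'a \<times> 'a" where
  "leapfrog_step G h p =
     (let x = fst p; v = snd p;
          x' = x + h *\<^sub>R v - (h^2 / 2) *\<^sub>R G x;
          v' = v - (h / 2) *\<^sub>R (G x + G x')
      in (x', v'))"

definition ham_flow_pos :: "('a::euclidean_space \<Rightarrow> 'a) \<Rightarrow> real \<Rightarrow> 'a \<Rightarrow> 'a \<Rightarrow> 'a" where
  "ham_flow_pos G T x v =
     (THE y. \<exists>X V. X 0 = x \<and> V 0 = v \<and>
        (\<forall>t\<in>{0..T}. (X has_vector_derivative V t) (at t within {0..T}) \<and>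
                     (V has_vector_derivative (- G (X t))) (at t within {0..T})) \<and>
        y = X T)"

definition qtil :: "('a::euclidean_space \<Rightarrow> 'a) \<Rightarrow> real \<Rightarrow> real \<Rightarrow> 'a \<Rightarrow> 'a \<Rightarrow> 'a" where
  "qtil G T h x v =
     (if h = 0 then ham_flow_pos G T x v
      else fst ((leapfrog_step G h ^^ nat \<lfloor>T / h\<rfloor>) (x, v)))"

definition std_gauss :: "'a::euclidean_space measure" where
  "std_gauss = density lborel
     (\<lambda>x::'a. ennreal ((2 * pi) powr (- real DIM('a) / 2) * exp (- ((norm x)^2 / 2))))"

definition Ptil :: "('a::euclidean_space \<Rightarrow> 'a) \<Rightarrow> real \<Rightarrow> real \<Rightarrow> 'a measure \<Rightarrow> 'a measure" where
  "Ptil G T h \<rho> = distr (\<rho> \<Otimes>\<^sub>M std_gauss) borel (\<lambda>(x, v). qtil G T h x v)"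

definition prob_borel :: "'a::euclidean_space measure \<Rightarrow> bool" where
  "prob_borel \<rho> \<longleftrightarrow> prob_space \<rho> \<and> sets \<rho> = sets (borel :: 'a measure)"

definition coupling :: "('a::euclidean_space \<times> 'a) measure \<Rightarrow> 'a measure \<Rightarrow> 'a measure \<Rightarrow> bool" where
  "coupling \<pi> \<mu> \<nu> \<longleftrightarrow> prob_space \<pi> \<and> sets \<pi> = sets (borel \<Otimes>\<^sub>M borel :: ('a \<times> 'a) measure) \<and>
     distr \<pi> borel fst = \<mu> \<and> distr \<pi> borel snd = \<nu>"

text \<open>Orlicz norm of X - Y where (X,Y) has joint law \<pi> (value \<infinity> if no admissible \<lambda>).\<close>
definition orlicz_diff :: "('a::euclidean_space \<times> 'a) measure \<Rightarrow> ereal" where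
  "orlicz_diff \<pi> = Inf {ereal l | l. l > 0 \<and>
      (\<integral>\<^sup>+ z. ennreal (exp ((norm (fst z - snd z))^2 / l^2)) \<partial>\<pi>) \<le> 2}"

definition W_psi :: "'a::euclidean_space measure \<Rightarrow> 'a measure \<Rightarrow> ereal" where
  "W_psi \<mu> \<nu> = Inf {orlicz_diff \<pi> | \<pi>. coupling \<pi> \<mu> \<nu>}"

definition renyi :: "real \<Rightarrow> 'a measure \<Rightarrow> 'a measure \<Rightarrow> ereal" where
  "renyi q \<mu> \<pi> =
     (if absolutely_continuous \<pi> \<mu> then
        (let I = \<integral>\<^sup>+ x. ennreal ((enn2real (RN_deriv \<pi> \<mu> x)) powr q) \<partial>\<pi>
         in if I = \<infinity> then \<infinity> else ereal (ln (enn2real I) / (q - 1)))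
      else \<infinity>)"

end

theory Submission
  imports Defs
begin

text \<open>Couple the steps started at \<open>x\<close> and \<open>y\<close> through their velocities: if \<open>q(x, v) = q(y, \<Phi> v)\<close>, then
  \<open>norm (\<Phi> v - v) \<le> 3 / (2 T) norm (x - y)\<close> and \<open>\<Phi>\<close> contracts distances at most by the factor
  \<open>exp (- 8 M T\<^sup>2 norm (x - y))\<close>. A Lipschitz map with constant \<open>K\<close> enlarges volumes at most by \<open>K ^ d\<close>
  (Vitali), so no Jacobian and no differentiability of the flow in its initial data is needed.
  Comparing the Gaussian weights of \<open>v\<close> and \<open>\<Phi> v\<close> by Young's inequality yields the dual form
  \[ P(\psi^{q-1})(x) \le \frac{1}{q} e^{\delta_1 |x-y| + \delta_2 |x-y|^2} + \Bigl(1 - \frac{1}{q}\Bigr) P(\psi^q)(y) \]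
  of a Renyi bound. It is linear in the laws of \<open>x\<close> and \<open>y\<close>, so it can be integrated over a coupling of
  \<open>\<mu> P^k\<close> and the stationary law. Contraction makes the Orlicz norm of \<open>x - y\<close> small enough for the
  exponential moment to be finite, and testing with truncations of the density recovers the Renyi
  divergence.\<close>

section \<open>Gaussian exponential moments\<close>

text \<open>Contraction acts only in \<open>W_psi\<close>, which says nothing about densities, so
  \<open>k\<close> of the \<open>k + 1\<close> steps bring the Orlicz distance below some
  \<open>w\<close> and the last one smooths. The exponent there has a linear part in
  \<open>norm (x - y)\<close>, while the Orlicz norm controls \<open>exp\<close> of a square;
  splitting the linear part optimally leads to \<open>\<delta>2 * w\<^sup>2 + \<delta>1 * w / (2 *
  sqrt (ln 2)) \<le> 1\<close>, and the threshold on \<open>k\<close> encodes the positive root of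
  this quadratic. In \<delta>1 the term with \<open>M\<close> is the volume distortion and the other
  one is the shift \<open>3 / (2 T)\<close> of the velocity times \<open>sqrt d\<close>, the size of
  a Gaussian vector; \<delta>2 is the squared shift times \<open>q (q - 1) / 2\<close>. The exact
  flow has no closed form, and the leapfrog map is an iterate. Both are free motion minus an
  accumulated force, and this common description with \<open>L * T\<^sup>2 \<le> 1 / 12\<close> lets
  one set of estimates serve both.\<close>

lemma nn_integral_exp_neg_square:
  fixes c :: real assumes "c > 0"
  shows "(\<integral>\<^sup>+x. ennreal (exp (- (c * x\<^sup>2))) \<partial>lborel) = ennreal (sqrt (pi / c))"
proof -
  define s where "s = 1 / sqrt (2 * c)"
  have s: "s > 0" "s\<^sup>2 = 1 / (2 * c)" using assms by (auto simp: s_def power_divide)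
  interpret prob_space "density lborel (\<lambda>x. ennreal (normal_density 0 s x))"
    by (rule prob_space_normal_density) (use s in auto)
  have 1: "(\<integral>\<^sup>+x. ennreal (normal_density 0 s x) \<partial>lborel) = 1"
    using emeasure_space_1 by (simp add: emeasure_density)
  have eq: "exp (- (c * x\<^sup>2)) = sqrt (pi / c) * normal_density 0 s x" for x
    using assms by (simp add: normal_density_def s field_simps real_sqrt_divide)
  show ?thesis
    unfolding eq using assms 1 by (subst ennreal_mult') (simp_all add: nn_integral_cmult)
qed

lemma nn_integral_exp_neg_norm_square:
  fixes c :: real assumes "c > 0"
  shows "(\<integral>\<^sup>+x. ennreal (exp (- (c * (norm (x::'a::euclidean_space))\<^sup>2))) \<partial>lborel)
    = ennreal ((pi / c) powr (real DIM('a) / 2))"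
proof -
  have "exp (- (c * (norm x)\<^sup>2)) = (\<Prod>b\<in>Basis. exp (- (c * (x \<bullet> b)\<^sup>2)))" for x :: 'a
    unfolding power2_norm_eq_inner euclidean_inner[of x x]
    by (simp add: exp_sum[symmetric] sum_distrib_left sum_negf power2_eq_square)
  then have "(\<integral>\<^sup>+x. ennreal (exp (- (c * (norm (x::'a))\<^sup>2))) \<partial>lborel)
    = (\<integral>\<^sup>+x. (\<Prod>b\<in>Basis. ennreal (exp (- (c * ((x::'a) \<bullet> b)\<^sup>2)))) \<partial>lborel)"
    by (simp add: prod_ennreal)
  also have "\<dots> = (\<Prod>b\<in>(Basis::'a set). (\<integral>\<^sup>+x. ennreal (exp (- (c * x\<^sup>2))) \<partial>lborel))"
    by (subst nn_integral_lborel_prod) auto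
  also have "\<dots> = ennreal (sqrt (pi / c) ^ DIM('a))"
    using assms by (simp add: nn_integral_exp_neg_square ennreal_power)
  also have "sqrt (pi / c) ^ DIM('a) = (pi / c) powr (real DIM('a) / 2)"
    using assms by (simp add: powr_half_sqrt[symmetric] powr_powr powr_realpow[symmetric])
  finally show ?thesis .
qed

text \<open>The moment generating function of a chi-square variable with \<open>DIM('a)\<close>
  degrees of freedom: the factor only changes the variance to \<open>1 / (1 - a)\<close>. The case
  \<open>a = 0\<close> yields the total mass of \<open>std_gauss\<close>.\<close>

lemma std_gauss_exp_norm_square:
  fixes a :: real assumes "a < 1"
  shows "(\<integral>\<^sup>+x. ennreal (exp (a / 2 * (norm x)\<^sup>2)) \<partial>(std_gauss :: 'a::euclidean_space measure))
    = ennreal ((1 - a) powr (- real DIM('a) / 2))"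
proof -
  let ?d = "real DIM('a)"
  let ?k = "(2 * pi) powr (- ?d / 2)"
  have "ennreal (?k * exp (- ((norm x)\<^sup>2 / 2))) * ennreal (exp (a / 2 * (norm x)\<^sup>2))
      = ennreal ?k * ennreal (exp (- ((1 - a) / 2 * (norm x)\<^sup>2)))" for x :: 'a
  proof -
    have "exp (- ((norm x)\<^sup>2 / 2)) * exp (a / 2 * (norm x)\<^sup>2) = exp (- ((1 - a) / 2 * (norm x)\<^sup>2))"
      unfolding exp_add[symmetric] by (rule arg_cong[of _ _ exp]) (simp add: field_simps)
    then show ?thesis
      by (simp add: ennreal_mult'[symmetric] mult.assoc)
  qed
  then have "(\<integral>\<^sup>+x. ennreal (exp (a / 2 * (norm x)\<^sup>2)) \<partial>(std_gauss :: 'a measure))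
     = (\<integral>\<^sup>+x. ennreal ?k * ennreal (exp (- ((1 - a) / 2 * (norm (x::'a))\<^sup>2))) \<partial>lborel)"
    unfolding std_gauss_def by (subst nn_integral_density) simp_all
  also have "\<dots> = ennreal ?k * ennreal ((pi / ((1 - a) / 2)) powr (?d / 2))"
    using assms nn_integral_exp_neg_norm_square[of "(1 - a) / 2", where 'a='a]
    by (subst nn_integral_cmult) simp_all
  also have "\<dots> = ennreal (?k * (pi / ((1 - a) / 2)) powr (?d / 2))"
    by (simp add: ennreal_mult')
  also have "?k * (pi / ((1 - a) / 2)) powr (?d / 2) = (1 - a) powr (- ?d / 2)"
  proof -
    have "pi / ((1 - a) / 2) = (2 * pi) / (1 - a)" by simp
    then have "(pi / ((1 - a) / 2)) powr (?d / 2) = (2 * pi) powr (?d / 2) / (1 - a) powr (?d / 2)"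
      using assms by (simp only: powr_divide)
    then show ?thesis by (simp add: powr_minus_divide minus_divide_left[symmetric])
  qed
  finally show ?thesis .
qed

lemma sets_std_gauss [measurable_cong, simp]: "sets std_gauss = sets borel"
  and space_std_gauss [simp]: "space std_gauss = UNIV"
  by (simp_all add: std_gauss_def)

lemma prob_space_std_gauss: "prob_space (std_gauss :: 'a::euclidean_space measure)"
proof
  show "emeasure std_gauss (space std_gauss :: 'a set) = 1"
    using std_gauss_exp_norm_square[of 0, where 'a='a] by simp
qed

text \<open>Both sides vanish at 1, and their difference has derivative
  \<open>(1 - 1 / s) * (1 + 1 / s\<^sup>2)\<close>. This is what remains of the Gaussian bound below
  once the dimension is scaled out.\<close>

lemma ln_le_rational:
  fixes s :: real assumes "s \<ge> 1"
  shows "ln s \<le> s - 1 / s - 1 / 2 + 1 / (2 * s\<^sup>2)"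
proof -
  let ?g = "\<lambda>s::real. s - 1 / s - 1 / 2 + 1 / (2 * s\<^sup>2) - ln s"
  have "?g 1 \<le> ?g s"
  proof (rule DERIV_nonneg_imp_nondecreasing[OF assms])
    fix x :: real assume x: "1 \<le> x" "x \<le> s"
    have "(?g has_real_derivative (1 + 1 / x\<^sup>2 - 1 / x ^ 3 - 1 / x)) (at x)"
      by (rule derivative_eq_intros refl | use x in force)+
        (use x in \<open>simp add: field_simps power2_eq_square power3_eq_cube\<close>)
    moreover have "1 + 1 / x\<^sup>2 - 1 / x ^ 3 - 1 / x = (1 - 1 / x) * (1 + 1 / x\<^sup>2)"
      using x by (simp add: field_simps power2_eq_square power3_eq_cube)
    moreover have "(1 - 1 / x) * (1 + 1 / x\<^sup>2) \<ge> 0"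
      using x by (intro mult_nonneg_nonneg) auto
    ultimately show "\<exists>y. (?g has_real_derivative y) (at x) \<and> 0 \<le> y"
      by (intro exI[of _ "1 + 1 / x\<^sup>2 - 1 / x ^ 3 - 1 / x"]) simp
  qed
  then show ?thesis by simp
qed

text \<open>Linearise the norm by \<open>norm x \<le> ((norm x)\<^sup>2 / s + s) / 2\<close> with the optimal \<open>s\<close>, the root of
  \<open>s\<^sup>2 - t s = d\<close>.\<close>
lemma std_gauss_exp_norm:
  fixes t :: real assumes t: "t \<ge> 0"
  shows "(\<integral>\<^sup>+x. ennreal (exp (t * norm x)) \<partial>(std_gauss :: 'a::euclidean_space measure))
    \<le> ennreal (exp (t * sqrt (real DIM('a)) + t\<^sup>2 / 2))"
proof -
  define d where "d = real DIM('a)"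
  have d: "d > 0" by (simp add: d_def)
  define s where "s = (t + sqrt (t\<^sup>2 + 4 * d)) / 2"
  have sq: "sqrt (t\<^sup>2 + 4 * d) ^ 2 = t\<^sup>2 + 4 * d" using d by simp
  have s_eq: "s\<^sup>2 = t * s + d" unfolding s_def using sq
    by (simp add: field_simps power2_eq_square)
  have ssd: "s \<ge> sqrt d"
  proof -
    have "sqrt (t\<^sup>2 + 4 * d) \<ge> sqrt (4 * d)" by simp
    then show ?thesis using t by (simp add: s_def real_sqrt_mult)
  qed
  have s0: "s > 0" using ssd d by (meson less_le_trans real_sqrt_gt_zero)
  \<comment> \<open>In terms of \<sigma>, \<open>t = sqrt d * (\<sigma> - 1 / \<sigma>)\<close> and
    \<open>1 - t / s = 1 / \<sigma>\<^sup>2\<close>, so every exponent becomes \<open>d\<close>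
    times a function of \<sigma> alone.\<close>
  define \<sigma> where "\<sigma> = s / sqrt d"
  have \<sigma>: "\<sigma> \<ge> 1" "s = \<sigma> * sqrt d" using ssd d by (auto simp: \<sigma>_def)
  have t_eq: "t = s - d / s" using s_eq s0 by (simp add: field_simps power2_eq_square)
  have "1 - t / s = (s\<^sup>2 - t * s) / s\<^sup>2" using s0 by (simp add: field_simps power2_eq_square)
  then have ts: "1 - t / s = d / s\<^sup>2" using s_eq by simp
  have ds: "d / s\<^sup>2 = 1 / \<sigma>\<^sup>2" using \<sigma> d by (simp add: power_mult_distrib)
  have lt1: "t / s < 1" using ts d s0 by (smt (verit) divide_pos_pos zero_less_power)
  have "t * norm x \<le> t / s / 2 * (norm x)\<^sup>2 + t * s / 2" for x :: 'a
  proof -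
    have "2 * norm x * s \<le> (norm x)\<^sup>2 + s\<^sup>2" by (rule sum_squares_bound)
    then have "norm x \<le> (norm x)\<^sup>2 / (2 * s) + s / 2" using s0
      by (simp add: field_simps power2_eq_square)
    from mult_left_mono[OF this t] show ?thesis by (simp add: algebra_simps)
  qed
  then have "(\<integral>\<^sup>+x. ennreal (exp (t * norm x)) \<partial>(std_gauss :: 'a measure))
    \<le> (\<integral>\<^sup>+x. ennreal (exp (t * s / 2)) * ennreal (exp (t / s / 2 * (norm x)\<^sup>2)) \<partial>(std_gauss :: 'a measure))"
    by (intro nn_integral_mono) (simp add: ennreal_mult'[symmetric] exp_add[symmetric] add.commute ennreal_leI)
  also have "\<dots> = ennreal (exp (t * s / 2) * (1 - t / s) powr (- d / 2))"
    using std_gauss_exp_norm_square[OF lt1, where 'a='a]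
    by (subst nn_integral_cmult) (simp_all add: ennreal_mult' d_def)
  also have "exp (t * s / 2) * (1 - t / s) powr (- d / 2) = exp (t * s / 2 + d * ln \<sigma>)"
  proof -
    have "(1 - t / s) powr (- d / 2) = exp (d * ln \<sigma>)"
      unfolding ts ds using \<sigma> by (simp add: powr_def ln_div ln_realpow)
    then show ?thesis by (simp add: exp_add)
  qed
  also have "\<dots> \<le> exp (t * sqrt d + t\<^sup>2 / 2)"
  proof -
    have te: "t = sqrt d * (\<sigma> - 1 / \<sigma>)"
      unfolding t_eq \<sigma>(2) using \<sigma>(1) d by (simp add: field_simps)
    have "t * s / 2 = d * ((\<sigma>\<^sup>2 - 1) / 2)"
      unfolding te \<sigma>(2) using \<sigma>(1) d by (simp add: field_simps power2_eq_square)
    moreover have "t * sqrt d = d * (\<sigma> - 1 / \<sigma>)" unfolding te using d by (simp add: field_simps)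
    moreover have "t\<^sup>2 / 2 = d * ((\<sigma> - 1 / \<sigma>)\<^sup>2 / 2)" unfolding te using d by (simp add: power_mult_distrib)
    moreover have "(\<sigma>\<^sup>2 - 1) / 2 + ln \<sigma> \<le> (\<sigma> - 1 / \<sigma>) + (\<sigma> - 1 / \<sigma>)\<^sup>2 / 2"
    proof -
      have "(\<sigma> - 1 / \<sigma>)\<^sup>2 = \<sigma>\<^sup>2 - 2 + 1 / \<sigma>\<^sup>2"
        using \<sigma>(1) by (simp add: power2_diff power_one_over)
      moreover have "1 / (2 * \<sigma>\<^sup>2) = (1 / \<sigma>\<^sup>2) / 2" by simp
      ultimately show ?thesis using ln_le_rational[OF \<sigma>(1)] unfolding diff_divide_distrib add_divide_distrib by linarith
    qed
    ultimately have "t * s / 2 + d * ln \<sigma> \<le> t * sqrt d + t\<^sup>2 / 2"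
      using d by (smt (verit) distrib_left mult_left_mono)
    then show ?thesis by simp
  qed
  finally show ?thesis by (simp add: d_def ennreal_leI)
qed

section \<open>Lebesgue measure and Lipschitz maps\<close>

text \<open>Integrating a sum of indicators gives subadditivity without enumerating
  \<open>I\<close>. Only an inequality is available, since the balls around image points may
  overlap.\<close>

lemma emeasure_UN_countable_le:
  assumes I: "countable I" and X: "\<And>i. i \<in> I \<Longrightarrow> X i \<in> sets M"
  shows "emeasure M (\<Union>i\<in>I. X i) \<le> (\<integral>\<^sup>+i. emeasure M (X i) \<partial>count_space I)"
proof -
  have "emeasure M (\<Union>i\<in>I. X i) = (\<integral>\<^sup>+z. indicator (\<Union>i\<in>I. X i) z \<partial>M)"
    using assms by (subst nn_integral_indicator) (auto intro: sets.countable_UN')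
  also have "\<dots> \<le> (\<integral>\<^sup>+z. (\<integral>\<^sup>+i. indicator (X i) z \<partial>count_space I) \<partial>M)"
  proof (rule nn_integral_mono)
    fix z
    show "indicator (\<Union>i\<in>I. X i) z \<le> (\<integral>\<^sup>+i. indicator (X i) z \<partial>count_space I)"
    proof (cases "z \<in> (\<Union>i\<in>I. X i)")
      case True
      then obtain i where i: "i \<in> I" "z \<in> X i" by auto
      then show ?thesis using nn_integral_ge_point[of i I "\<lambda>i. indicator (X i) z"] True by simp
    qed simp
  qed
  also have "\<dots> = (\<integral>\<^sup>+i. (\<integral>\<^sup>+z. indicator (X i) z \<partial>M) \<partial>count_space I)"
    using assms by (intro nn_integral_count_space_nn_integral) auto
  also have "\<dots> = (\<integral>\<^sup>+i. emeasure M (X i) \<partial>count_space I)"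
    using X by (intro nn_integral_cong) auto
  finally show ?thesis .
qed

text \<open>By Vitali's theorem, an open set is, up to a null set, a disjoint union of balls, whose images
  lie in balls of \<open>K\<close> times the radius.\<close>
lemma emeasure_lipschitz_image_open:
  fixes g :: "'a::euclidean_space \<Rightarrow> 'a"
  assumes lip: "\<And>x y. norm (g x - g y) \<le> K * norm (x - y)" and K: "K > 0"
    and U: "open U" and A: "A \<in> sets borel" "A \<subseteq> g ` U"
  shows "emeasure lborel A \<le> ennreal (K ^ DIM('a)) * emeasure lborel U"
proof -
  let ?P = "{p::'a \<times> real. 0 < snd p \<and> ball (fst p) (snd p) \<subseteq> U}"
  obtain C where C: "countable C" "C \<subseteq> ?P"
     "pairwise (\<lambda>i j. disjnt (ball (fst i) (snd i)) (ball (fst j) (snd j))) C"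
     "negligible (U - (\<Union>i \<in> C. ball (fst i) (snd i)))"
  proof (rule Vitali_covering_theorem_balls[of U ?P fst snd])
    fix x d assume x: "x \<in> U" and "0 < (d::real)"
    then obtain e where "e > 0" "ball x e \<subseteq> U" using U openE by blast
    then show "\<exists>i. i \<in> ?P \<and> x \<in> ball (fst i) (snd i) \<and> snd i < d"
      using \<open>0 < d\<close> by (intro exI[of _ "(x, min e d / 2)"]) (auto simp: subset_eq)
  qed blast
  define N where "N = U - (\<Union>i \<in> C. ball (fst i) (snd i))"
  have "negligible (g ` N)"
    by (rule negligible_locally_Lipschitz_image[OF order_refl]) (use C(4) lip N_def in \<open>auto intro!: exI[of _ UNIV]\<close>)
  then have gN: "g ` N \<in> null_sets lebesgue" by (simp add: negligible_iff_null_sets)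
  have cover: "A \<subseteq> g ` N \<union> (\<Union>i\<in>C. ball (g (fst i)) (K * snd i))"
  proof
    fix z assume "z \<in> A"
    then obtain u where u: "u \<in> U" "z = g u" using A by auto
    show "z \<in> g ` N \<union> (\<Union>i\<in>C. ball (g (fst i)) (K * snd i))"
    proof (cases "u \<in> N")
      case False
      then obtain i where i: "i \<in> C" "dist (fst i) u < snd i" using u by (auto simp: N_def)
      have "dist (g (fst i)) z \<le> K * dist (fst i) u" using lip u by (simp add: dist_norm)
      also have "\<dots> < K * snd i" using i K by simp
      finally show ?thesis using i by auto
    qed (use u in auto)
  qed
  have bS: "(\<Union>i\<in>C. ball (g (fst i)) (K * snd i)) \<in> sets borel" by (simp add: C(1) open_UN borel_open)
  \<comment> \<open>The image of \<open>N\<close> need not be Borel, hence the detour through the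
    completion \<open>lebesgue\<close>; \<open>A\<close> and the union of balls are Borel.\<close>
  have "emeasure lborel A = emeasure lebesgue A" using A by simp
  also have "\<dots> \<le> emeasure lebesgue (g ` N \<union> (\<Union>i\<in>C. ball (g (fst i)) (K * snd i)))"
    by (rule emeasure_mono[OF cover]) (use gN bS in auto)
  also have "\<dots> = emeasure lebesgue (\<Union>i\<in>C. ball (g (fst i)) (K * snd i))"
    by (subst Un_commute, rule emeasure_Un_null_set) (use gN bS in auto)
  also have "\<dots> = emeasure lborel (\<Union>i\<in>C. ball (g (fst i)) (K * snd i))"
    using bS by simp
  also have "\<dots> \<le> (\<integral>\<^sup>+i. emeasure lborel (ball (g (fst i)) (K * snd i)) \<partial>count_space C)"
    by (rule emeasure_UN_countable_le) (use C in auto)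
  also have "\<dots> = (\<integral>\<^sup>+i. ennreal (K ^ DIM('a)) * emeasure lborel (ball (fst i) (snd i)) \<partial>count_space C)"
    using C(2) K by (intro nn_integral_cong)
      (auto simp: emeasure_ball subset_eq power_mult_distrib ennreal_mult'[symmetric] mult_ac)
  also have "\<dots> = ennreal (K ^ DIM('a)) * (\<integral>\<^sup>+i. emeasure lborel (ball (fst i) (snd i)) \<partial>count_space C)"
    by (rule nn_integral_cmult) auto
  also have "(\<integral>\<^sup>+i. emeasure lborel (ball (fst i) (snd i)) \<partial>count_space C)
    = emeasure lborel (\<Union>i\<in>C. ball (fst i) (snd i))"
    by (rule emeasure_UN_countable[symmetric])
      (use C in \<open>auto simp: disjoint_family_on_def pairwise_def disjnt_def\<close>)
  also have "\<dots> \<le> emeasure lborel U"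
    by (rule emeasure_mono) (use C(2) U in auto)
  finally show ?thesis by (simp add: mult_left_mono)
qed

text \<open>Outer regularity reduces this to open sets. The Borel set \<open>A\<close> stands in for
  the image itself, whose measurability is then not an issue.\<close>

lemma emeasure_lipschitz_image:
  fixes g :: "'a::euclidean_space \<Rightarrow> 'a"
  assumes lip: "\<And>x y. norm (g x - g y) \<le> K * norm (x - y)" and K: "K > 0"
    and B: "B \<in> sets borel" and A: "A \<in> sets borel" "A \<subseteq> g ` B"
  shows "emeasure lborel A \<le> ennreal (K ^ DIM('a)) * emeasure lborel B"
proof (rule ennreal_le_epsilon)
  fix e :: real assume e: "e > 0"
  obtain U where U: "open U" "B \<subseteq> U" "emeasure lborel (U - B) < e / K ^ DIM('a)"
    using outer_regular_lborel[OF B, of "e / K ^ DIM('a)"] e K by auto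
  have "emeasure lborel A \<le> ennreal (K ^ DIM('a)) * emeasure lborel U"
    by (rule emeasure_lipschitz_image_open[OF lip K U(1) A(1)]) (use A U in auto)
  also have "emeasure lborel U = emeasure lborel B + emeasure lborel (U - B)"
    using plus_emeasure[of B lborel "U - B"] B U(1,2) by (auto simp: Un_absorb1)
  also have "\<dots> \<le> emeasure lborel B + ennreal (e / K ^ DIM('a))"
    using U(3) by (intro add_left_mono less_imp_le)
  also have "ennreal (K ^ DIM('a)) * \<dots> = ennreal (K ^ DIM('a)) * emeasure lborel B + ennreal e"
    using K e by (simp add: distrib_left ennreal_mult'[symmetric])
  finally show "emeasure lborel A \<le> ennreal (K ^ DIM('a)) * emeasure lborel B + ennreal e"
    by (simp add: mult_left_mono)
qed

text \<open>A one-sided change of variables without Jacobian: expansion makes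
  \<open>inv \<Phi>\<close> Lipschitz, so preimages under \<Phi> are Lipschitz images, and the
  resulting inequality of measures passes to integrals.\<close>

lemma nn_integral_expanding_map:
  fixes \<Phi> :: "'a::euclidean_space \<Rightarrow> 'a" and \<phi> :: "'a \<Rightarrow> ennreal"
  assumes exp: "\<And>v w. norm (v - w) \<le> K * norm (\<Phi> v - \<Phi> w)" and K: "K > 0"
    and surj: "surj \<Phi>" and [measurable]: "\<Phi> \<in> borel_measurable borel" "\<phi> \<in> borel_measurable borel"
  shows "(\<integral>\<^sup>+v. \<phi> (\<Phi> v) \<partial>lborel) \<le> ennreal (K ^ DIM('a)) * (\<integral>\<^sup>+u. \<phi> u \<partial>lborel)"
proof -
  have inv: "\<Phi> (inv \<Phi> u) = u" for u by (simp add: surj_f_inv_f[OF surj])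
  have lip: "norm (inv \<Phi> u - inv \<Phi> w) \<le> K * norm (u - w)" for u w
    using exp[of "inv \<Phi> u" "inv \<Phi> w"] by (simp add: inv)
  have inj: "v = w" if "\<Phi> v = \<Phi> w" for v w using exp[of v w] that by simp
  have img: "\<Phi> -` B = inv \<Phi> ` B" for B
    using inv inj by (auto simp: image_iff) (metis)
  let ?D = "density lborel (\<lambda>_. ennreal (K ^ DIM('a))) :: 'a measure"
  have "emeasure (distr lborel borel \<Phi>) B \<le> emeasure ?D B" for B
  proof (cases "B \<in> sets borel")
    case True
    have vB: "\<Phi> -` B \<in> sets borel"
      using measurable_sets[of \<Phi> borel borel B] True by simp
    have "emeasure lborel (\<Phi> -` B) \<le> ennreal (K ^ DIM('a)) * emeasure lborel B"
      by (rule emeasure_lipschitz_image[OF lip K True vB]) (use img in simp)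
    then show ?thesis using True by (simp add: emeasure_distr emeasure_density_const)
  qed (simp add: emeasure_notin_sets)
  then have le: "distr lborel borel \<Phi> \<le> ?D"
    by (auto simp: le_measure_iff le_fun_def)
  have "(\<integral>\<^sup>+v. \<phi> (\<Phi> v) \<partial>lborel) = (\<integral>\<^sup>+u. \<phi> u \<partial>distr lborel borel \<Phi>)"
    by (subst nn_integral_distr) auto
  also have "\<dots> \<le> (\<integral>\<^sup>+u. \<phi> u \<partial>?D)"
    by (rule nn_integral_mono_measure[OF _ le]) simp
  also have "\<dots> = ennreal (K ^ DIM('a)) * (\<integral>\<^sup>+u. \<phi> u \<partial>lborel)"
    by (simp add: nn_integral_density nn_integral_cmult)
  finally show ?thesis .
qed

section \<open>Hamiltonian trajectories\<close>

text \<open>Plays the role of Gronwall's lemma: \<open>step\<close> applied to the supremum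
  \<open>B\<close> gives \<open>B \<le> c + a * B\<close>. Boundedness of the family allows
  \<open>a * B\<close> to be moved to the left.\<close>

lemma norm_bound_absorb:
  fixes f :: "'i \<Rightarrow> 'a::real_normed_vector"
  assumes bdd: "bounded (f ` I)" and a: "a < 1"
    and step: "\<And>B i. i \<in> I \<Longrightarrow> (\<And>j. j \<in> I \<Longrightarrow> norm (f j) \<le> B) \<Longrightarrow> norm (f i) \<le> c + a * B"
    and i: "i \<in> I"
  shows "norm (f i) \<le> c / (1 - a)"
proof -
  define B where "B = (SUP j\<in>I. norm (f j))"
  have bd: "bdd_above ((\<lambda>j. norm (f j)) ` I)"
    using bdd unfolding bounded_iff bdd_above_def by auto
  have le: "norm (f j) \<le> B" if "j \<in> I" for j
    unfolding B_def by (rule cSUP_upper[OF that bd])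
  have "B \<le> c + a * B"
    unfolding B_def by (rule cSUP_least) (use i step[OF _ le] in \<open>auto simp: B_def\<close>)
  then have "B \<le> c / (1 - a)" using a by (simp add: field_simps)
  then show ?thesis using le[OF i] by linarith
qed

text \<open>Positions \<open>X i = x + tm i *\<^sub>R v - S i (G \<circ> X)\<close> of a discretised or continuous Hamiltonian
  trajectory, where \<open>S\<close> is the accumulated force (a double sum or a double integral), \<open>e\<close> is the
  final index and \<open>adm\<close> singles out the functions to which \<open>S\<close> may be applied.\<close>
locale hamiltonian_trajectories =
  fixes I :: "'i set" and tm :: "'i \<Rightarrow> real" and e :: 'i
    and S :: "'i \<Rightarrow> ('i \<Rightarrow> 'a::euclidean_space) \<Rightarrow> 'a" and adm :: "('i \<Rightarrow> 'a) \<Rightarrow> bool"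
    and G :: "'a \<Rightarrow> 'a" and L M T :: real and F :: "'a \<Rightarrow> 'a \<Rightarrow> 'a"
  assumes e: "e \<in> I" "tm e = T" and tm: "\<And>i. i \<in> I \<Longrightarrow> 0 \<le> tm i \<and> tm i \<le> T" and T: "T > 0"
    and adm_diff: "\<And>f g. adm f \<Longrightarrow> adm g \<Longrightarrow> adm (\<lambda>i. f i - g i)"
    and adm_G: "\<And>f. adm f \<Longrightarrow> adm (\<lambda>i. G (f i))"
    and adm_bounded: "\<And>f. adm f \<Longrightarrow> bounded (f ` I)"
    and S_diff: "\<And>f g i. adm f \<Longrightarrow> adm g \<Longrightarrow> i \<in> I \<Longrightarrow> S i (\<lambda>j. f j - g j) = S i f - S i g"
    and S_bound: "\<And>f B i. adm f \<Longrightarrow> (\<And>j. j \<in> I \<Longrightarrow> norm (f j) \<le> B) \<Longrightarrow> i \<in> I \<Longrightarrow> norm (S i f) \<le> T\<^sup>2 * B"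
    and L: "L \<ge> 0" and M: "M \<ge> 0" and small: "L * T\<^sup>2 \<le> 1 / 12"
    and G_lip: "\<And>a b. norm (G a - G b) \<le> L * norm (a - b)"
    and G_second: "\<And>a a' b b' D. norm (a - b) \<le> D \<Longrightarrow> norm (a' - b') \<le> D \<Longrightarrow>
      norm ((G a - G a') - (G b - G b')) \<le> L * norm ((a - a') - (b - b')) + M * D * norm (a - a')"
    and F: "\<And>x v. \<exists>X. adm X \<and> (\<forall>i\<in>I. X i = x + tm i *\<^sub>R v - S i (\<lambda>j. G (X j))) \<and> X e = F x v"
begin

definition traj :: "'a \<Rightarrow> 'a \<Rightarrow> ('i \<Rightarrow> 'a) \<Rightarrow> bool" where
  "traj x v X \<longleftrightarrow> adm X \<and> (\<forall>i\<in>I. X i = x + tm i *\<^sub>R v - S i (\<lambda>j. G (X j)))"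

lemma traj_adm: "traj x v X \<Longrightarrow> adm X"
  by (simp add: traj_def)

lemma traj_obtain: obtains X where "traj x v X" "X e = F x v"
  using F[of x v] by (auto simp: traj_def)

definition sdiff :: "('i \<Rightarrow> 'a) \<Rightarrow> ('i \<Rightarrow> 'a) \<Rightarrow> 'i \<Rightarrow> 'a" where
  "sdiff X Y i = S i (\<lambda>j. G (X j)) - S i (\<lambda>j. G (Y j))"

text \<open>The factor is \<open>L * T\<^sup>2\<close>, Lipschitz constant times size of the
  accumulated force. The constants 12/11, 6/5 and 11/10 below arise from absorbing this
  twelfth.\<close>

lemma sdiff_bound:
  assumes "adm X" "adm Y" "i \<in> I" and B: "\<And>j. j \<in> I \<Longrightarrow> norm (X j - Y j) \<le> B"
  shows "norm (sdiff X Y i) \<le> B / 12"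
proof -
  have B0: "B \<ge> 0" using B[OF e(1)] norm_ge_zero by (rule order_trans[rotated])
  have "norm (G (X j) - G (Y j)) \<le> L * B" if "j \<in> I" for j
    using G_lip[of "X j" "Y j"] mult_left_mono[OF B[OF that] L] by linarith
  then have "norm (S i (\<lambda>j. G (X j) - G (Y j))) \<le> T\<^sup>2 * (L * B)"
    using assms by (intro S_bound adm_diff adm_G) auto
  also have "\<dots> = (L * T\<^sup>2) * B" by simp
  also have "\<dots> \<le> 1 / 12 * B" using small B0 by (rule mult_right_mono)
  finally show ?thesis using assms by (simp add: sdiff_def S_diff adm_G)
qed

lemma traj_diff:
  assumes "traj x v X" "traj y u Y" "i \<in> I"
  shows "X i - Y i = (x - y) + tm i *\<^sub>R (v - u) - sdiff X Y i"
proof -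
  have "X i = x + tm i *\<^sub>R v - S i (\<lambda>j. G (X j))" "Y i = y + tm i *\<^sub>R u - S i (\<lambda>j. G (Y j))"
    using assms by (auto simp: traj_def)
  then show ?thesis unfolding sdiff_def by (simp add: algebra_simps)
qed

lemma traj_diff_bounded:
  assumes "traj x v X" "traj y u Y"
  shows "bounded ((\<lambda>i. X i - Y i) ` I)"
  using assms by (intro adm_bounded adm_diff) (auto dest: traj_adm)

text \<open>Absorption with \<open>a = 1 / 12\<close>. For equal initial data it says that the
  trajectory is unique on \<open>I\<close>, which later identifies the exact flow.\<close>

lemma traj_stable:
  assumes X: "traj x v X" and Y: "traj y u Y" and i: "i \<in> I"
  shows "norm (X i - Y i) \<le> 12 / 11 * (norm (x - y) + T * norm (v - u))"
proof -
  have "norm (X i - Y i) \<le> (norm (x - y) + T * norm (v - u)) / (1 - 1 / 12)"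
  proof (rule norm_bound_absorb[where I = I and f = "\<lambda>i. X i - Y i"])
    fix B i assume i: "i \<in> I" and B: "\<And>j. j \<in> I \<Longrightarrow> norm (X j - Y j) \<le> B"
    have "norm (X i - Y i) \<le> norm (x - y) + norm (tm i *\<^sub>R (v - u)) + norm (sdiff X Y i)"
      unfolding traj_diff[OF X Y i] by (meson add_right_mono norm_triangle_ineq norm_triangle_ineq4 order_trans)
    moreover have "norm (tm i *\<^sub>R (v - u)) \<le> T * norm (v - u)"
      using tm[OF i] by (auto intro: mult_right_mono)
    moreover have "norm (sdiff X Y i) \<le> B / 12"
      using X Y i B by (intro sdiff_bound) (auto dest: traj_adm)
    ultimately show "norm (X i - Y i) \<le> norm (x - y) + T * norm (v - u) + 1 / 12 * B" by simp
  qed (use i traj_diff_bounded[OF X Y] in auto)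
  then show ?thesis by simp
qed

section \<open>The endpoint as a function of the velocity\<close>

lemma F_lipschitz: "norm (F x v - F y u) \<le> 12 / 11 * (norm (x - y) + T * norm (v - u))"
proof -
  obtain X Y where "traj x v X" "X e = F x v" "traj y u Y" "Y e = F y u"
    by (meson traj_obtain)
  then show ?thesis using traj_stable[OF _ _ e(1)] by metis
qed

text \<open>The only deviation from free motion is a force difference, a twelfth of the 12/11 in
  \<open>traj_stable\<close>. Expansion, injectivity and surjectivity in the velocity follow from
  this.\<close>

lemma F_near_linear: "norm (F x v - F x u - T *\<^sub>R (v - u)) \<le> T * norm (v - u) / 11"
proof -
  obtain X Y where X: "traj x v X" "X e = F x v" and Y: "traj x u Y" "Y e = F x u"
    by (meson traj_obtain)
  have "norm (sdiff X Y e) \<le> (12 / 11 * (norm (x - x) + T * norm (v - u))) / 12"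
    using X Y e traj_stable[OF X(1) Y(1)] by (intro sdiff_bound) (auto dest: traj_adm)
  moreover have "F x v - F x u - T *\<^sub>R (v - u) = - sdiff X Y e"
    using traj_diff[OF X(1) Y(1) e(1)] X Y e by simp
  ultimately show ?thesis by simp
qed

lemma F_expanding: "10 / 11 * T * norm (v - u) \<le> norm (F x v - F x u)"
proof -
  have "norm (T *\<^sub>R (v - u)) \<le> norm (F x v - F x u) + norm (F x v - F x u - T *\<^sub>R (v - u))"
    using norm_triangle_ineq4[of "F x v - F x u" "F x v - F x u - T *\<^sub>R (v - u)"] by simp
  then show ?thesis using F_near_linear[of x v u] T by simp
qed

lemma inj_F: "inj (F x)"
proof (rule injI)
  fix v u assume "F x v = F x u"
  then show "v = u" using F_expanding[of v u x] T by (simp add: mult_le_0_iff)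
qed

text \<open>A fixed point of the simplified Newton step \<open>v + (z - F x v) /\<^sub>R T\<close>
  solves the equation, and by \<open>F_near_linear\<close> the step contracts by 1/11.\<close>

lemma surj_F: "surj (F x)"
  unfolding surj_def
proof
  fix z
  have "\<exists>!v. v + (z - F x v) /\<^sub>R T = v"
  proof (rule banach_fix_type[of "1 / 11"], safe)
    fix v u
    have "v + (z - F x v) /\<^sub>R T - (u + (z - F x u) /\<^sub>R T) = - (F x v - F x u - T *\<^sub>R (v - u)) /\<^sub>R T"
      using T by (simp add: algebra_simps)
    then have "norm (v + (z - F x v) /\<^sub>R T - (u + (z - F x u) /\<^sub>R T))
       = norm (F x v - F x u - T *\<^sub>R (v - u)) / T"
      using T by (simp add: divide_inverse_commute norm_minus_commute)
    also have "\<dots> \<le> 1 / 11 * norm (v - u)"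
      using F_near_linear[of x v u] T by (simp add: field_simps)
    finally show "dist (v + (z - F x v) /\<^sub>R T) (u + (z - F x u) /\<^sub>R T) \<le> 1 / 11 * dist v u"
      by (simp add: dist_norm)
  qed auto
  then obtain v where "v + (z - F x v) /\<^sub>R T = v" by auto
  then show "\<exists>v. z = F x v" using T by auto
qed

section \<open>Velocities that lead to a common endpoint\<close>

text \<open>Solving the endpoint equation for \<open>v - u\<close> replaces it by boundary data.\<close>
lemma traj_same_end:
  assumes X: "traj x v X" and Y: "traj y u Y" and eq: "X e = Y e"
  shows "i \<in> I \<Longrightarrow> norm (X i - Y i) \<le> 6 / 5 * norm (x - y)"
    and "T * norm (v - u) \<le> 11 / 10 * norm (x - y)"
proof -
  have end_eq: "T *\<^sub>R (v - u) = sdiff X Y e - (x - y)"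
    using traj_diff[OF X Y e(1)] eq e by (simp add: algebra_simps)
  have main: "norm (X i - Y i) \<le> norm (x - y) / (1 - 1 / 6)" if i: "i \<in> I" for i
  proof (rule norm_bound_absorb[where I = I and f = "\<lambda>i. X i - Y i"])
    fix B i assume i: "i \<in> I" and B: "\<And>j. j \<in> I \<Longrightarrow> norm (X j - Y j) \<le> B"
    have c: "0 \<le> tm i / T" "tm i / T \<le> 1" using tm[OF i] T by auto
    have "tm i *\<^sub>R (v - u) = (tm i / T) *\<^sub>R (T *\<^sub>R (v - u))" using T by simp
    \<comment> \<open>With \<open>v - u\<close> eliminated, the weights are at most 1 and two force
      differences remain, each costing a twelfth: hence \<open>1 / 6\<close>, and 6/5 after
      absorption.\<close>
    then have "X i - Y i = (1 - tm i / T) *\<^sub>R (x - y) + (tm i / T) *\<^sub>R sdiff X Y e - sdiff X Y i"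
      unfolding traj_diff[OF X Y i] end_eq by (simp add: algebra_simps)
    then have "norm (X i - Y i) \<le> norm ((1 - tm i / T) *\<^sub>R (x - y)) + norm ((tm i / T) *\<^sub>R sdiff X Y e)
        + norm (sdiff X Y i)"
      using norm_triangle_ineq4 norm_triangle_ineq by (smt (verit))
    moreover have "norm ((1 - tm i / T) *\<^sub>R (x - y)) \<le> norm (x - y)"
      using c by (simp add: mult_left_le_one_le)
    moreover have "norm ((tm i / T) *\<^sub>R sdiff X Y e) \<le> norm (sdiff X Y e)"
      unfolding norm_scaleR abs_of_nonneg[OF c(1)] using c by (intro mult_left_le_one_le) auto
    moreover have "norm (sdiff X Y i) \<le> B / 12" "norm (sdiff X Y e) \<le> B / 12"
      using sdiff_bound[OF traj_adm[OF X] traj_adm[OF Y] _ B] i e(1) by auto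
    ultimately show "norm (X i - Y i) \<le> norm (x - y) + 1 / 6 * B"
      by linarith
  qed (use i traj_diff_bounded[OF X Y] in auto)
  have main': "norm (X i - Y i) \<le> 6 / 5 * norm (x - y)" if "i \<in> I" for i
    using main[OF that] by simp
  then show "i \<in> I \<Longrightarrow> norm (X i - Y i) \<le> 6 / 5 * norm (x - y)" .
  have "norm (sdiff X Y e) \<le> (6 / 5 * norm (x - y)) / 12"
    by (rule sdiff_bound[OF traj_adm[OF X] traj_adm[OF Y] e(1) main'])
  moreover have "norm (T *\<^sub>R (v - u)) \<le> norm (sdiff X Y e) + norm (x - y)"
    unfolding end_eq by (rule norm_triangle_ineq4)
  ultimately show "T * norm (v - u) \<le> 11 / 10 * norm (x - y)" using T by simp
qed

text \<open>\<open>traj_same_end\<close> gives 11/10, relaxed here to the 3/2 that enters \<delta>1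
  and \<delta>2.\<close>

lemma F_coupling:
  assumes "F x v = F y u"
  shows "norm (v - u) \<le> 3 / (2 * T) * norm (x - y)"
proof -
  obtain X Y where X: "traj x v X" "X e = F x v" and Y: "traj y u Y" "Y e = F y u"
    by (meson traj_obtain)
  have "T * norm (v - u) \<le> 11 / 10 * norm (x - y)"
    using traj_same_end(2)[OF X(1) Y(1)] X Y assms by simp
  also have "\<dots> \<le> 3 / 2 * norm (x - y)" by simp
  finally show ?thesis using T by (simp add: field_simps)
qed

text \<open>A second-order version of \<open>traj_same_end\<close>. In the second difference
  \<open>E\<close> of the positions the starting points cancel, and the coupling makes it vanish at
  \<open>e\<close>. It is driven only by the second difference of the forces: a part proportional to
  \<open>E\<close>, which is absorbed, and a product of two first differences.\<close>

lemma F_coupling_diff: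
  assumes eq: "F x v = F y u" and eq': "F x v' = F y u'"
  shows "norm ((v - v') - (u - u')) \<le> 2 * M * T\<^sup>2 * norm (x - y) * norm (v - v')"
proof -
  obtain X Y X' Y' where X: "traj x v X" "X e = F x v" and Y: "traj y u Y" "Y e = F y u"
    and X': "traj x v' X'" "X' e = F x v'" and Y': "traj y u' Y'" "Y' e = F y u'"
    by (meson traj_obtain)
  have adm: "adm X" "adm Y" "adm X'" "adm Y'" using X X' Y Y' by (auto dest: traj_adm)
  \<comment> \<open>\<open>D\<close> bounds the distance of coupled trajectories, \<open>N\<close>
    that of trajectories with the same start, and \<open>Q\<close> the resulting part of the force
    that is not absorbed.\<close>
  define D where "D = 6 / 5 * norm (x - y)"
  define N where "N = 12 / 11 * (T * norm (v - v'))"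
  define Q where "Q = T\<^sup>2 * (M * D * N)"
  have D0: "D \<ge> 0" by (simp add: D_def)
  have DX: "norm (X i - Y i) \<le> D" if "i \<in> I" for i
    using traj_same_end(1)[OF X(1) Y(1) _ that] X Y eq by (simp add: D_def)
  have DX': "norm (X' i - Y' i) \<le> D" if "i \<in> I" for i
    using traj_same_end(1)[OF X'(1) Y'(1) _ that] X' Y' eq' by (simp add: D_def)
  have NX: "norm (X i - X' i) \<le> N" if "i \<in> I" for i
    using traj_stable[OF X(1) X'(1) that] by (simp add: N_def)
  define E where "E i = (X i - X' i) - (Y i - Y' i)" for i
  define s where "s i = sdiff X X' i - sdiff Y Y' i" for i
  have s_bound: "norm (s i) \<le> Q + B / 12" if i: "i \<in> I" and B: "\<And>j. j \<in> I \<Longrightarrow> norm (E j) \<le> B" for i B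
  proof -
    have B0: "B \<ge> 0" using B[OF e(1)] norm_ge_zero by (rule order_trans[rotated])
    have "norm ((G (X j) - G (X' j)) - (G (Y j) - G (Y' j))) \<le> L * B + M * D * N" if j: "j \<in> I" for j
    proof -
      have "norm ((G (X j) - G (X' j)) - (G (Y j) - G (Y' j)))
        \<le> L * norm (E j) + M * D * norm (X j - X' j)"
        unfolding E_def by (rule G_second[OF DX[OF j] DX'[OF j]])
      also have "\<dots> \<le> L * B + M * D * N"
        using L M D0 B[OF j] NX[OF j] by (intro add_mono mult_left_mono) auto
      finally show ?thesis .
    qed
    then have "norm (S i (\<lambda>j. (G (X j) - G (X' j)) - (G (Y j) - G (Y' j)))) \<le> T\<^sup>2 * (L * B + M * D * N)"
      using adm i by (intro S_bound adm_diff adm_G) auto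
    also have "\<dots> = (L * T\<^sup>2) * B + Q" by (simp add: Q_def algebra_simps)
    also have "\<dots> \<le> 1 / 12 * B + Q" using small B0 by (intro add_right_mono mult_right_mono)
    finally show ?thesis using adm i by (simp add: s_def sdiff_def S_diff adm_G adm_diff)
  qed
  have E_eq: "E i = tm i *\<^sub>R ((v - v') - (u - u')) - s i" if "i \<in> I" for i
    unfolding E_def s_def traj_diff[OF X(1) X'(1) that] traj_diff[OF Y(1) Y'(1) that]
    by (simp add: algebra_simps)
  have "E e = 0" using X X' Y Y' eq eq' by (simp add: E_def)
  then have end_eq: "T *\<^sub>R ((v - v') - (u - u')) = s e" using E_eq[OF e(1)] e(2) by simp
  have E_bound: "norm (E i) \<le> (2 * Q) / (1 - 1 / 6)" if i: "i \<in> I" for i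
  proof (rule norm_bound_absorb[where I = I and f = E])
    have "adm E" unfolding E_def[abs_def] using adm by (intro adm_diff)
    then show "bounded (E ` I)" by (rule adm_bounded)
    fix B i assume i: "i \<in> I" and B: "\<And>j. j \<in> I \<Longrightarrow> norm (E j) \<le> B"
    have c: "0 \<le> tm i / T" "tm i / T \<le> 1" using tm[OF i] T by auto
    have "tm i *\<^sub>R ((v - v') - (u - u')) = (tm i / T) *\<^sub>R (T *\<^sub>R ((v - v') - (u - u')))" using T by simp
    then have "E i = (tm i / T) *\<^sub>R s e - s i"
      using E_eq[OF i] end_eq by simp
    then have "norm (E i) \<le> norm ((tm i / T) *\<^sub>R s e) + norm (s i)"
      by (simp only: norm_triangle_ineq4)
    moreover have "norm ((tm i / T) *\<^sub>R s e) \<le> norm (s e)"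
      unfolding norm_scaleR abs_of_nonneg[OF c(1)] using c by (intro mult_left_le_one_le) auto
    ultimately show "norm (E i) \<le> 2 * Q + 1 / 6 * B"
      using s_bound[OF i B] s_bound[OF e(1) B] by linarith
  qed (use i in auto)
  have "T * norm ((v - v') - (u - u')) = norm (s e)"
    unfolding end_eq[symmetric] using T by simp
  also have "\<dots> \<le> Q + (2 * Q) / (1 - 1 / 6) / 12"
    by (rule s_bound[OF e(1) E_bound])
  \<comment> \<open>One 6/5 is \<open>1 + 2 * (6 / 5) / 12\<close> from the absorption, the other
    sits in \<open>D\<close>, and 12/11 in \<open>N\<close>; the product is below 2.\<close>
  also have "\<dots> = 6 / 5 * (6 / 5) * (12 / 11) * (M * T\<^sup>2 * norm (x - y) * (T * norm (v - v')))"
    by (simp add: Q_def D_def N_def)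
  also have "\<dots> \<le> 2 * (M * T\<^sup>2 * norm (x - y) * (T * norm (v - v')))"
    using M T by (intro mult_right_mono mult_nonneg_nonneg) auto
  finally show ?thesis using T by (simp add: field_simps)
qed

text \<open>With \<epsilon> the factor of \<open>F_coupling_diff\<close>, the triangle inequality
  gives \<open>1 / (1 - \<epsilon>) \<le> exp (2 * \<epsilon>)\<close>, which works only for small
  \<epsilon>. For large \<epsilon> the expansion and Lipschitz bounds give a plain 6/5. The exponent
  \<open>4 * \<epsilon>\<close> covers both cases and is the source of the 8 in \<delta>1.\<close>

lemma F_coupling_expanding:
  assumes eq: "F x v = F y u" and eq': "F x v' = F y u'"
  shows "norm (v - v') \<le> exp (8 * M * T\<^sup>2 * norm (x - y)) * norm (u - u')"
proof -
  define \<epsilon> where "\<epsilon> = 2 * M * T\<^sup>2 * norm (x - y)"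
  have \<epsilon>0: "\<epsilon> \<ge> 0" using M by (simp add: \<epsilon>_def)
  have "norm (v - v') \<le> exp (4 * \<epsilon>) * norm (u - u')"
  proof (cases "\<epsilon> \<le> 1 / 2")
    case True
    have "norm (v - v') \<le> norm (u - u') + norm ((v - v') - (u - u'))" using norm_triangle_ineq[of "u - u'" "(v - v') - (u - u')"] by simp
    then have 1: "(1 - \<epsilon>) * norm (v - v') \<le> norm (u - u')"
      using F_coupling_diff[OF eq eq'] by (simp add: \<epsilon>_def algebra_simps)
    have "1 \<le> (1 + 2 * \<epsilon>) * (1 - \<epsilon>)"
      using True \<epsilon>0 mult_left_mono[OF True \<epsilon>0] by (simp add: algebra_simps)
    also have "\<dots> \<le> exp (2 * \<epsilon>) * (1 - \<epsilon>)"
      using True by (intro mult_right_mono exp_ge_add_one_self) auto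
    also have "\<dots> \<le> exp (4 * \<epsilon>) * (1 - \<epsilon>)"
      using True \<epsilon>0 by (intro mult_right_mono) auto
    finally have "norm (v - v') \<le> exp (4 * \<epsilon>) * (1 - \<epsilon>) * norm (v - v')"
      using mult_right_mono[OF _ norm_ge_zero[of "v - v'"]] by fastforce
    also have "\<dots> \<le> exp (4 * \<epsilon>) * norm (u - u')"
      using mult_left_mono[OF 1, of "exp (4 * \<epsilon>)"] by (simp add: mult.assoc)
    finally show ?thesis .
  next
    case False
    have "10 / 11 * T * norm (v - v') \<le> norm (F x v - F x v')" by (rule F_expanding)
    also have "\<dots> \<le> 12 / 11 * (T * norm (u - u'))"
      using F_lipschitz[of y u y u'] by (simp add: eq eq')
    finally have "norm (v - v') \<le> 6 / 5 * norm (u - u')" using T by simp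
    also have "\<dots> \<le> exp (4 * \<epsilon>) * norm (u - u')"
    proof (rule mult_right_mono)
      show "6 / 5 \<le> exp (4 * \<epsilon>)" using exp_ge_add_one_self[of "4 * \<epsilon>"] False by linarith
    qed simp
    finally show ?thesis .
  qed
  then show ?thesis by (simp add: \<epsilon>_def mult.assoc)
qed

end

text \<open>All that the probabilistic part knows about the dynamics. The constant in
  \<open>expanding\<close> may depend on \<open>x\<close>, as it serves only the measurability of
  \<open>inv (F x)\<close>.\<close>

locale coupled_maps =
  fixes F :: "'a::euclidean_space \<Rightarrow> 'a \<Rightarrow> 'a" and M T :: real
  assumes T: "T > 0" and M: "M \<ge> 0"
    and continuous: "continuous_on UNIV (\<lambda>p. F (fst p) (snd p))"
    and inj: "inj (F x)" and surj: "surj (F x)"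
    and expanding: "\<exists>c. c > 0 \<and> (\<forall>v u. norm (v - u) \<le> c * norm (F x v - F x u))"
    and coupling: "F x v = F y u \<Longrightarrow> norm (v - u) \<le> 3 / (2 * T) * norm (x - y)"
    and coupling_expanding: "F x v = F y u \<Longrightarrow> F x v' = F y u' \<Longrightarrow>
      norm (v - v') \<le> exp (8 * M * T\<^sup>2 * norm (x - y)) * norm (u - u')"

lemma (in hamiltonian_trajectories) coupled_maps: "coupled_maps F M T"
proof
  show "continuous_on UNIV (\<lambda>p. F (fst p) (snd p))"
  proof (rule lipschitz_on_continuous_on[of "12 / 11 * (1 + T)"], rule lipschitz_onI)
    fix p q :: "'a \<times> 'a"
    have "norm (fst p - fst q) \<le> norm (p - q)" "norm (snd p - snd q) \<le> norm (p - q)"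
      using norm_fst_le[of "fst p - fst q" "snd p - snd q"] norm_snd_le[of "snd p - snd q" "fst p - fst q"]
      by (simp_all add: minus_prod_def)
    then have "12 / 11 * (norm (fst p - fst q) + T * norm (snd p - snd q))
       \<le> 12 / 11 * (norm (p - q) + T * norm (p - q))"
      using T by (intro mult_left_mono add_mono) auto
    then show "dist (F (fst p) (snd p)) (F (fst q) (snd q)) \<le> 12 / 11 * (1 + T) * dist p q"
      using F_lipschitz[of "fst p" "snd p" "fst q" "snd q"] by (simp add: dist_norm algebra_simps)
  qed (use T in auto)
  show "\<exists>c. c > 0 \<and> (\<forall>v u. norm (v - u) \<le> c * norm (F x v - F x u))" for x
    using F_expanding[of _ _ x] T by (intro exI[of _ "11 / (10 * T)"]) (auto simp: field_simps)
qed (use T M inj_F surj_F F_coupling F_coupling_expanding in auto)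

section \<open>The leapfrog scheme\<close>

lemma lipschitz_of_derivative_bound:
  fixes G :: "'a::euclidean_space \<Rightarrow> 'a" and H :: "'a \<Rightarrow> ('a \<Rightarrow>\<^sub>L 'a)"
  assumes hess: "\<forall>x. (G has_derivative blinfun_apply (H x)) (at x)" and bd: "\<forall>x. norm (H x) \<le> L"
  shows "norm (G a - G b) \<le> L * norm (a - b)"
  by (rule differentiable_bound[of UNIV G "\<lambda>x. blinfun_apply (H x)"])
    (use assms in \<open>auto simp: norm_blinfun.rep_eq[symmetric]\<close>)

text \<open>Traverse the segments from \<open>a'\<close> to \<open>a\<close> and from
  \<open>b'\<close> to \<open>b\<close> simultaneously, at points \<open>p\<close> and
  \<open>r\<close>. The derivative splits into \<open>(H p - H r) (a - a')\<close>, where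
  \<open>p - r\<close> is a convex combination of the end differences and so the Hessians differ by
  at most \<open>M * D\<close>, and \<open>H r\<close> applied to the second difference.\<close>

lemma second_difference_bound:
  fixes G :: "'a::euclidean_space \<Rightarrow> 'a" and H :: "'a \<Rightarrow> ('a \<Rightarrow>\<^sub>L 'a)"
  assumes hess: "\<forall>x. (G has_derivative blinfun_apply (H x)) (at x)" and hess_bd: "\<forall>x. norm (H x) \<le> L"
    and third: "\<forall>x. (H has_derivative blinfun_apply (D3 x)) (at x)" and third_bd: "\<forall>x. norm (D3 x) \<le> M"
    and D: "norm (a - b) \<le> D" "norm (a' - b') \<le> D"
  shows "norm ((G a - G a') - (G b - G b')) \<le> L * norm ((a - a') - (b - b')) + M * D * norm (a - a')"
proof -
  have M: "M \<ge> 0" using third_bd norm_ge_zero order_trans by blast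
  have D0: "D \<ge> 0" using D(1) norm_ge_zero order_trans by blast
  define g where "g = (\<lambda>s::real. G (a' + s *\<^sub>R (a - a')) - G (b' + s *\<^sub>R (b - b')))"
  define w where "w s = H (a' + s *\<^sub>R (a - a')) (a - a') - H (b' + s *\<^sub>R (b - b')) (b - b')" for s :: real
  let ?B = "L * norm ((a - a') - (b - b')) + M * D * norm (a - a')"
  have G': "((\<lambda>s. G (p + s *\<^sub>R r)) has_derivative (\<lambda>t. t *\<^sub>R H (p + s *\<^sub>R r) r)) (at s within {0..1})"
    for p r and s :: real
  proof -
    have "((\<lambda>s. p + s *\<^sub>R r) has_derivative (\<lambda>t. t *\<^sub>R r)) (at s within {0..1})"
      by (auto intro!: derivative_eq_intros)
    from has_derivative_compose[OF this hess[rule_format]]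
    show ?thesis by (simp add: blinfun.scaleR_right)
  qed
  have wB: "norm (w s) \<le> ?B" if s: "s \<in> {0..1}" for s
  proof -
    let ?p = "a' + s *\<^sub>R (a - a')" and ?r = "b' + s *\<^sub>R (b - b')"
    have "?p - ?r = (1 - s) *\<^sub>R (a' - b') + s *\<^sub>R (a - b)" by (simp add: algebra_simps)
    then have "norm (?p - ?r) \<le> (1 - s) * norm (a' - b') + s * norm (a - b)"
      using s norm_triangle_ineq[of "(1 - s) *\<^sub>R (a' - b')" "s *\<^sub>R (a - b)"] by simp
    also have "\<dots> \<le> (1 - s) * D + s * D" using s D by (intro add_mono mult_left_mono) auto
    finally have pr: "norm (?p - ?r) \<le> D" by (simp add: algebra_simps)
    have "norm (H ?p - H ?r) \<le> M * norm (?p - ?r)"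
      by (rule differentiable_bound[of UNIV H "\<lambda>x. blinfun_apply (D3 x)"])
        (use third third_bd in \<open>auto simp: norm_blinfun.rep_eq[symmetric]\<close>)
    also have "\<dots> \<le> M * D" using pr M by (rule mult_left_mono)
    finally have HH: "norm (H ?p - H ?r) \<le> M * D" .
    have "w s = (H ?p - H ?r) (a - a') + H ?r ((a - a') - (b - b'))"
      by (simp add: w_def blinfun.diff_left blinfun.diff_right)
    then have "norm (w s) \<le> norm ((H ?p - H ?r) (a - a')) + norm (H ?r ((a - a') - (b - b')))"
      by (simp only: norm_triangle_ineq)
    also have "\<dots> \<le> M * D * norm (a - a') + L * norm ((a - a') - (b - b'))"
      using HH hess_bd
      by (intro add_mono order_trans[OF norm_blinfun] mult_right_mono) auto
    finally show ?thesis by simp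
  qed
  have "norm (g 1 - g 0) \<le> ?B * norm (1 - 0 :: real)"
  proof (rule differentiable_bound[of "{0..1}" g "\<lambda>s t. t *\<^sub>R w s"])
    fix s :: real assume s: "s \<in> {0..1}"
    show "(g has_derivative (\<lambda>t. t *\<^sub>R w s)) (at s within {0..1})"
      using has_derivative_diff[OF G'[of a' "a - a'" s] G'[of b' "b - b'" s]]
      by (simp only: g_def w_def scaleR_diff_right[of _ "blinfun_apply _ _"])
    have "norm (t *\<^sub>R w s) \<le> ?B * norm t" for t
      using mult_left_mono[OF wB[OF s], of "\<bar>t\<bar>"] by (simp add: mult.commute)
    then show "onorm (\<lambda>t. t *\<^sub>R w s) \<le> ?B" by (rule onorm_le)
  qed auto
  then show ?thesis by (simp add: g_def algebra_simps)
qed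

text \<open>The scheme unfolded: before step \<open>j\<close> the velocity has lost
  \<open>h / 2\<close> times the inner sum, which the position update multiplies by \<open>h\<close>
  and to which it adds its own kick \<open>g j\<close>. It is the discrete form of a double time
  integral.\<close>

definition leapfrog_force :: "real \<Rightarrow> nat \<Rightarrow> (nat \<Rightarrow> 'a::euclidean_space) \<Rightarrow> 'a" where
  "leapfrog_force h k g = (\<Sum>j<k. (h\<^sup>2 / 2) *\<^sub>R (g j + (\<Sum>l<j. g l + g (Suc l))))"

lemma leapfrog_force_bound:
  assumes "\<And>j. j \<le> N \<Longrightarrow> norm (g j) \<le> B" and k: "k \<le> N"
  shows "norm (leapfrog_force h k g) \<le> (real N * h)\<^sup>2 * B"
proof -
  have B: "B \<ge> 0" using assms(1)[of 0] norm_ge_zero[of "g 0"] by linarith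
  have "norm ((h\<^sup>2 / 2) *\<^sub>R (g j + (\<Sum>l<j. g l + g (Suc l)))) \<le> h\<^sup>2 * (real N * B)" if j: "j < k" for j
  proof -
    have "norm (\<Sum>l<j. g l + g (Suc l)) \<le> (\<Sum>l<j. 2 * B)"
    proof (rule sum_norm_le)
      fix l assume "l \<in> {..<j}"
      then show "norm (g l + g (Suc l)) \<le> 2 * B"
        using assms(1)[of l] assms(1)[of "Suc l"] j k norm_triangle_ineq[of "g l" "g (Suc l)"] by auto
    qed
    then have "norm (g j + (\<Sum>l<j. g l + g (Suc l))) \<le> B + real j * (2 * B)"
      using assms(1)[of j] j k norm_triangle_ineq[of "g j" "\<Sum>l<j. g l + g (Suc l)"] by simp
    also have "\<dots> = (1 + 2 * real j) * B" by (simp add: algebra_simps)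
    \<comment> \<open>Here \<open>j < k \<le> N\<close> gives \<open>1 + 2 j \<le> 2 N\<close>, so
      the total is \<open>(N h)\<^sup>2\<close>, which is \<open>T\<^sup>2\<close> in the
      application, as for the double integral.\<close>
    also have "\<dots> \<le> (2 * real N) * B" using j k B by (intro mult_right_mono) auto
    finally have "norm (g j + (\<Sum>l<j. g l + g (Suc l))) \<le> 2 * (real N * B)" by simp
    from mult_left_mono[OF this, of "h\<^sup>2 / 2"] show ?thesis by simp
  qed
  then have "norm (leapfrog_force h k g) \<le> (\<Sum>j<k. h\<^sup>2 * (real N * B))"
    unfolding leapfrog_force_def by (intro sum_norm_le) auto
  also have "\<dots> = real k * (h\<^sup>2 * (real N * B))" by simp
  also have "\<dots> \<le> real N * (h\<^sup>2 * (real N * B))" using k B by (intro mult_right_mono) auto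
  finally show ?thesis by (simp add: power2_eq_square mult_ac)
qed

lemma leapfrog_position:
  fixes G :: "'a::euclidean_space \<Rightarrow> 'a" and h :: real
  defines "p \<equiv> \<lambda>k x v. (leapfrog_step G h ^^ k) (x, v)"
  shows "snd (p k x v) = v - (h / 2) *\<^sub>R (\<Sum>l<k. G (fst (p l x v)) + G (fst (p (Suc l) x v)))"
    and "fst (p k x v) = x + (real k * h) *\<^sub>R v - leapfrog_force h k (\<lambda>j. G (fst (p j x v)))"
proof -
  have step: "fst (p (Suc k) x v) = fst (p k x v) + h *\<^sub>R snd (p k x v) - (h\<^sup>2 / 2) *\<^sub>R G (fst (p k x v))"
    "snd (p (Suc k) x v) = snd (p k x v) - (h / 2) *\<^sub>R (G (fst (p k x v)) + G (fst (p (Suc k) x v)))" for k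
    by (simp_all add: p_def leapfrog_step_def Let_def)
  have p0: "p 0 x v = (x, v)" by (simp add: p_def)
  show V: "snd (p k x v) = v - (h / 2) *\<^sub>R (\<Sum>l<k. G (fst (p l x v)) + G (fst (p (Suc l) x v)))" for k
    by (induction k) (simp_all only: step(2) p0, simp_all add: algebra_simps)
  show "fst (p k x v) = x + (real k * h) *\<^sub>R v - leapfrog_force h k (\<lambda>j. G (fst (p j x v)))"
  proof (induction k)
    case (Suc k)
    let ?s = "\<Sum>l<k. G (fst (p l x v)) + G (fst (p (Suc l) x v))"
    let ?f = "leapfrog_force h k (\<lambda>j. G (fst (p j x v)))"
    have "fst (p (Suc k) x v) = (x + (real k * h) *\<^sub>R v - ?f) + h *\<^sub>R (v - (h / 2) *\<^sub>R ?s)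
        - (h\<^sup>2 / 2) *\<^sub>R G (fst (p k x v))"
      using step(1)[of k] Suc V[of k] by presburger
    also have "\<dots> = x + (real (Suc k) * h) *\<^sub>R v - (?f + (h\<^sup>2 / 2) *\<^sub>R (G (fst (p k x v)) + ?s))"
      by (simp add: algebra_simps power2_eq_square)
    finally show ?case by (simp add: leapfrog_force_def)
  qed (simp add: p0 leapfrog_force_def)
qed

lemma leapfrog_coupled_maps:
  fixes G :: "'a::euclidean_space \<Rightarrow> 'a"
  assumes "T > 0" "T = real N * h" "L \<ge> 0" "M \<ge> 0" "L * T\<^sup>2 \<le> 1 / 12"
    and "\<And>a b. norm (G a - G b) \<le> L * norm (a - b)"
    and "\<And>a a' b b' D. norm (a - b) \<le> D \<Longrightarrow> norm (a' - b') \<le> D \<Longrightarrow>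
      norm ((G a - G a') - (G b - G b')) \<le> L * norm ((a - a') - (b - b')) + M * D * norm (a - a')"
  shows "coupled_maps (\<lambda>x v. fst ((leapfrog_step G h ^^ N) (x, v))) M T"
\<comment> \<open>On finitely many indices every function is bounded, so \<open>adm\<close> imposes
  nothing.\<close>
proof (rule hamiltonian_trajectories.coupled_maps[where I = "{..N}" and tm = "\<lambda>i. real i * h" and e = N
      and S = "leapfrog_force h" and adm = "\<lambda>_. True" and G = G and L = L], unfold_locales)
  show "N \<in> {..N}" by simp
  show "real N * h = T" using assms(2) by simp
  have h: "h \<ge> 0" using assms(1,2) by (simp add: zero_less_mult_iff)
  show "0 \<le> real i * h \<and> real i * h \<le> T" if "i \<in> {..N}" for i
    using that h assms(2) by (auto intro: mult_right_mono)
  show "norm (leapfrog_force h i f) \<le> T\<^sup>2 * B" if "\<And>j. j \<in> {..N} \<Longrightarrow> norm (f j) \<le> B" "i \<in> {..N}"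
    for f :: "nat \<Rightarrow> 'a" and B i
    using leapfrog_force_bound[of N f B i h] that assms(2) by simp
  show "leapfrog_force h i (\<lambda>j. f j - g j) = leapfrog_force h i f - leapfrog_force h i g"
    for f g :: "nat \<Rightarrow> 'a" and i
    by (simp add: leapfrog_force_def sum_subtractf sum.distrib algebra_simps)
  show "\<exists>X. True \<and> (\<forall>i\<in>{..N}. X i = x + (real i * h) *\<^sub>R v - leapfrog_force h i (\<lambda>j. G (X j)))
      \<and> X N = fst ((leapfrog_step G h ^^ N) (x, v))" for x v
    by (intro exI[of _ "\<lambda>k. fst ((leapfrog_step G h ^^ k) (x, v))"] conjI ballI TrueI refl leapfrog_position(2))
qed (use assms in \<open>auto simp: finite_imp_bounded\<close>)

section \<open>The Hamiltonian flow\<close>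

definition flow_force :: "real \<Rightarrow> (real \<Rightarrow> 'a::euclidean_space) \<Rightarrow> 'a" where
  "flow_force t g = integral {0..t} (\<lambda>s. integral {0..s} g)"

lemma continuous_on_inner_integral:
  fixes g :: "real \<Rightarrow> 'a::euclidean_space"
  assumes "continuous_on {0..T} g" "t \<le> T"
  shows "continuous_on {0..t} (\<lambda>s. integral {0..s} g)"
  using assms by (intro indefinite_integral_continuous_1 integrable_continuous_real)
    (auto intro: continuous_on_subset)

lemma flow_force_diff:
  fixes f g :: "real \<Rightarrow> 'a::euclidean_space"
  assumes f: "continuous_on {0..T} f" and g: "continuous_on {0..T} g" and t: "t \<le> T"
  shows "flow_force t (\<lambda>s. f s - g s) = flow_force t f - flow_force t g"
proof -
  have "integral {0..s} (\<lambda>r. f r - g r) = integral {0..s} f - integral {0..s} g" if "s \<in> {0..t}" for s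
    using that t by (intro integral_diff integrable_continuous_real continuous_on_subset[OF f]
        continuous_on_subset[OF g]) auto
  then have "flow_force t (\<lambda>s. f s - g s) = integral {0..t} (\<lambda>s. integral {0..s} f - integral {0..s} g)"
    unfolding flow_force_def by (intro integral_cong) auto
  also have "\<dots> = flow_force t f - flow_force t g"
    unfolding flow_force_def using assms
    by (intro integral_diff integrable_continuous_real continuous_on_inner_integral) auto
  finally show ?thesis .
qed

lemma flow_force_bound:
  fixes g :: "real \<Rightarrow> 'a::euclidean_space"
  assumes g: "continuous_on {0..T} g" and t: "0 \<le> t" "t \<le> T"
    and B: "\<And>s. s \<in> {0..T} \<Longrightarrow> norm (g s) \<le> B"
  shows "norm (flow_force t g) \<le> T\<^sup>2 * B"
proof -
  have B0: "B \<ge> 0" using order_trans[OF norm_ge_zero B[of 0]] t by simp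
  have "norm (integral {0..s} g) \<le> B * T" if "s \<in> {0..t}" for s
  proof -
    have "norm (integral {0..s} g) \<le> B * (s - 0)"
      using that t B by (intro integral_bound continuous_on_subset[OF g]) auto
    also have "\<dots> \<le> B * T" using that t B0 by (intro mult_left_mono) auto
    finally show ?thesis .
  qed
  then have "norm (flow_force t g) \<le> B * T * (t - 0)"
    unfolding flow_force_def using g t by (intro integral_bound continuous_on_inner_integral) auto
  also have "\<dots> \<le> B * T * T" using t B0 by (intro mult_left_mono) auto
  finally show ?thesis by (simp add: power2_eq_square mult_ac)
qed

lemma continuous_on_flow_force:
  assumes "continuous_on {0..T} g"
  shows "continuous_on {0..T} (\<lambda>t. flow_force t g)"
  unfolding flow_force_def using assms
  by (intro indefinite_integral_continuous_1 integrable_continuous_real continuous_on_inner_integral) auto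

text \<open>Picard iteration for the twice integrated equation. It contracts by
  \<open>L * T\<^sup>2 \<le> 1 / 12\<close> on all of \<open>{0..T}\<close> at once, so no local
  solutions have to be glued.\<close>

lemma flow_exists:
  fixes G :: "'a::euclidean_space \<Rightarrow> 'a"
  assumes T: "T > 0" and small: "L * T\<^sup>2 \<le> 1 / 12"
    and G_lip: "\<And>a b. norm (G a - G b) \<le> L * norm (a - b)" and G: "continuous_on UNIV G"
  shows "\<exists>X. continuous_on {0..T} X \<and> (\<forall>t\<in>{0..T}. X t = x + t *\<^sub>R v - flow_force t (\<lambda>s. G (X s)))"
proof -
  \<comment> \<open>Freezing time outside \<open>{0..T}\<close> turns the iteration into a self-map
    of the complete space of bounded continuous functions on the whole line.\<close>
  define c where "c t = max 0 (min T t)" for t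
  have c: "0 \<le> c t" "c t \<le> T" for t using T by (auto simp: c_def)
  have c_id: "c t = t" if "t \<in> {0..T}" for t using that by (auto simp: c_def)
  have cont_c: "continuous_on UNIV c" unfolding c_def by (intro continuous_intros)
  have GX: "continuous_on {0..T} (\<lambda>s. G (apply_bcontfun X s))" for X
    by (rule continuous_on_compose2[OF G]) auto
  define P where "P X t = x + c t *\<^sub>R v - flow_force (c t) (\<lambda>s. G (apply_bcontfun X s))"
    for X :: "real \<Rightarrow>\<^sub>C 'a" and t
  have P: "P X \<in> bcontfun" for X
  proof -
    let ?Q = "\<lambda>t. x + t *\<^sub>R v - flow_force t (\<lambda>s. G (apply_bcontfun X s))"
    have Q: "continuous_on {0..T} ?Q"
      by (intro continuous_intros continuous_on_flow_force GX)
    have "continuous_on UNIV (P X)"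
      unfolding P_def[abs_def] by (rule continuous_on_compose2[OF Q cont_c]) (use c in auto)
    moreover have "bounded (range (P X))"
    proof (rule bounded_subset)
      show "bounded (?Q ` {0..T})" by (intro compact_imp_bounded compact_continuous_image Q) simp
    qed (auto simp: P_def intro!: imageI c)
    ultimately show ?thesis by (simp add: bcontfun_def)
  qed
  have dP: "dist (P X t) (P Y t) \<le> 1 / 12 * dist X Y" for X Y t
  proof -
    have "P Y t - P X t = flow_force (c t) (\<lambda>s. G (apply_bcontfun X s)) - flow_force (c t) (\<lambda>s. G (apply_bcontfun Y s))"
      by (simp add: P_def)
    also have "\<dots> = flow_force (c t) (\<lambda>s. G (apply_bcontfun X s) - G (apply_bcontfun Y s))"
      by (rule flow_force_diff[OF GX GX c(2), symmetric])
    finally have "norm (P Y t - P X t) \<le> T\<^sup>2 * (L * dist X Y)"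
    proof (simp only:, intro flow_force_bound continuous_on_diff GX c)
      fix s
      have L: "L \<ge> 0" using order_trans[OF norm_ge_zero G_lip[of "SOME b. b \<in> Basis" 0]]
        by (simp add: SOME_Basis)
      have "norm (G (X s) - G (Y s)) \<le> L * dist (X s) (Y s)" using G_lip by (simp add: dist_norm)
      also have "\<dots> \<le> L * dist X Y" using L by (intro mult_left_mono dist_bounded)
      finally show "norm (G (X s) - G (Y s)) \<le> L * dist X Y" .
    qed
    also have "\<dots> = (L * T\<^sup>2) * dist X Y" by simp
    also have "\<dots> \<le> 1 / 12 * dist X Y" using small by (intro mult_right_mono) auto
    finally show ?thesis by (simp add: dist_norm norm_minus_commute)
  qed
  have "\<exists>!X. Bcontfun (P X) = X"
  proof (rule banach_fix_type[of "1 / 12"])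
    show "\<forall>X Y. dist (Bcontfun (P X)) (Bcontfun (P Y)) \<le> 1 / 12 * dist X Y"
      by (intro allI dist_bound) (simp only: Bcontfun_inverse[OF P] dP)
  qed auto
  then obtain X where "Bcontfun (P X) = X" by auto
  then have X: "apply_bcontfun X = P X" by (metis Bcontfun_inverse[OF P])
  have "X t = x + t *\<^sub>R v - flow_force t (\<lambda>s. G (X s))" if "t \<in> {0..T}" for t
    using fun_cong[OF X, of t] by (simp add: P_def c_id[OF that])
  then show ?thesis by (intro exI[of _ "apply_bcontfun X"]) auto
qed

text \<open>Links the system in \<open>ham_flow_pos\<close> to the form demanded by
  \<open>hamiltonian_trajectories\<close>: integrate twice in one direction, differentiate the
  double integral in the other.\<close>

lemma flow_ode_iff:
  fixes G :: "'a::euclidean_space \<Rightarrow> 'a"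
  assumes T: "T > 0" and G: "continuous_on UNIV G"
  shows "(\<exists>X V. X 0 = x \<and> V 0 = v \<and>
        (\<forall>t\<in>{0..T}. (X has_vector_derivative V t) (at t within {0..T}) \<and>
                     (V has_vector_derivative (- G (X t))) (at t within {0..T})) \<and> y = X T)
     \<longleftrightarrow> (\<exists>X. continuous_on {0..T} X \<and>
           (\<forall>t\<in>{0..T}. X t = x + t *\<^sub>R v - flow_force t (\<lambda>s. G (X s))) \<and> y = X T)"
    (is "?ode \<longleftrightarrow> ?int")
proof
  assume ?ode
  then obtain X V where X0: "X 0 = x" "V 0 = v" and y: "y = X T"
    and dX: "\<And>t. t \<in> {0..T} \<Longrightarrow> (X has_vector_derivative V t) (at t within {0..T})"
    and dV: "\<And>t. t \<in> {0..T} \<Longrightarrow> (V has_vector_derivative (- G (X t))) (at t within {0..T})"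
    by auto
  have X: "continuous_on {0..T} X"
    using dX has_vector_derivative_continuous continuous_on_eq_continuous_within by blast
  have GX: "continuous_on {0..T} (\<lambda>s. G (X s))" by (rule continuous_on_compose2[OF G X]) auto
  have V: "V t = v - integral {0..t} (\<lambda>s. G (X s))" if t: "t \<in> {0..T}" for t
  proof -
    have "((\<lambda>s. - G (X s)) has_integral (V t - V 0)) {0..t}"
      using t by (intro fundamental_theorem_of_calculus has_vector_derivative_within_subset[OF dV]) auto
    then have "integral {0..t} (\<lambda>s. - G (X s)) = V t - v" using X0 integral_unique by blast
    then show ?thesis by (simp add: algebra_simps)
  qed
  have "X t = x + t *\<^sub>R v - flow_force t (\<lambda>s. G (X s))" if t: "t \<in> {0..T}" for t
  proof -
    have "(V has_integral (X t - X 0)) {0..t}"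
      using t by (intro fundamental_theorem_of_calculus has_vector_derivative_within_subset[OF dX]) auto
    then have "X t - x = integral {0..t} V" using X0 by (simp add: integral_unique)
    also have "\<dots> = integral {0..t} (\<lambda>s. v - integral {0..s} (\<lambda>r. G (X r)))"
      using t V by (intro integral_cong) auto
    also have "\<dots> = integral {0..t} (\<lambda>s. v) - flow_force t (\<lambda>s. G (X s))"
      unfolding flow_force_def using t
      by (intro integral_diff integrable_continuous_real continuous_on_inner_integral[OF GX]) auto
    finally show ?thesis using t by (simp add: algebra_simps)
  qed
  then show ?int using X y by auto
next
  assume ?int
  then obtain Y where Y: "continuous_on {0..T} Y" and y: "y = Y T"
    and eq: "\<And>t. t \<in> {0..T} \<Longrightarrow> Y t = x + t *\<^sub>R v - flow_force t (\<lambda>s. G (Y s))" by auto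
  have GY: "continuous_on {0..T} (\<lambda>s. G (Y s))" by (rule continuous_on_compose2[OF G Y]) auto
  define V where "V t = v - integral {0..t} (\<lambda>s. G (Y s))" for t
  have dY: "(Y has_vector_derivative V t) (at t within {0..T})" if t: "t \<in> {0..T}" for t
  proof -
    have "((\<lambda>t. x + t *\<^sub>R v - flow_force t (\<lambda>s. G (Y s))) has_vector_derivative
        (0 + 1 *\<^sub>R v - integral {0..t} (\<lambda>s. G (Y s)))) (at t within {0..T})"
      unfolding flow_force_def
      by (intro has_vector_derivative_diff has_vector_derivative_add has_vector_derivative_const
          integral_has_vector_derivative t continuous_on_inner_integral[OF GY] order_refl)
        (auto intro!: derivative_eq_intros)
    then have "((\<lambda>t. x + t *\<^sub>R v - flow_force t (\<lambda>s. G (Y s))) has_vector_derivative V t) (at t within {0..T})"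
      by (simp add: V_def)
    then show ?thesis
      by (rule has_vector_derivative_transform[OF t, rotated]) (use eq in auto)
  qed
  have dV: "(V has_vector_derivative - G (Y t)) (at t within {0..T})" if t: "t \<in> {0..T}" for t
  proof -
    have "((\<lambda>t. v - integral {0..t} (\<lambda>s. G (Y s))) has_vector_derivative (0 - G (Y t))) (at t within {0..T})"
      by (intro has_vector_derivative_diff has_vector_derivative_const integral_has_vector_derivative GY t)
    then show ?thesis by (simp add: V_def[abs_def])
  qed
  show ?ode
    using eq[of 0] T y dY dV by (intro exI[of _ Y] exI[of _ V]) (auto simp: V_def flow_force_def)
qed

lemma flow_coupled_maps:
  fixes G :: "'a::euclidean_space \<Rightarrow> 'a"
  assumes T: "T > 0" and L: "L \<ge> 0" and M: "M \<ge> 0" and small: "L * T\<^sup>2 \<le> 1 / 12"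
    and G_lip: "\<And>a b. norm (G a - G b) \<le> L * norm (a - b)"
    and G_second: "\<And>a a' b b' D. norm (a - b) \<le> D \<Longrightarrow> norm (a' - b') \<le> D \<Longrightarrow>
      norm ((G a - G a') - (G b - G b')) \<le> L * norm ((a - a') - (b - b')) + M * D * norm (a - a')"
  shows "coupled_maps (ham_flow_pos G T) M T"
proof -
  have G: "continuous_on UNIV G"
    by (rule lipschitz_on_continuous_on[of L]) (use G_lip L in \<open>auto intro!: lipschitz_onI simp: dist_norm\<close>)
  have "\<forall>x v. \<exists>X. continuous_on {0..T} X \<and> (\<forall>t\<in>{0..T}. X t = x + t *\<^sub>R v - flow_force t (\<lambda>s. G (X s)))"
    using flow_exists[OF T small G_lip G] by blast
  then obtain \<X> where \<X>: "\<And>x v. continuous_on {0..T} (\<X> x v)"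
    "\<And>x v t. t \<in> {0..T} \<Longrightarrow> \<X> x v t = x + t *\<^sub>R v - flow_force t (\<lambda>s. G (\<X> x v s))"
    by metis
  interpret hamiltonian_trajectories "{0..T}" "\<lambda>t. t" T flow_force "continuous_on {0..T}" G L M T "\<lambda>x v. \<X> x v T"
  proof unfold_locales
    show "continuous_on {0..T} (\<lambda>i. G (f i))" if "continuous_on {0..T} f" for f
      by (rule continuous_on_compose2[OF G that]) auto
    show "bounded (f ` {0..T})" if "continuous_on {0..T} f" for f :: "real \<Rightarrow> 'a"
      by (intro compact_imp_bounded compact_continuous_image that) simp
    show "\<exists>X. continuous_on {0..T} X \<and> (\<forall>i\<in>{0..T}. X i = x + i *\<^sub>R v - flow_force i (\<lambda>j. G (X j))) \<and> X T = \<X> x v T" for x v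
      by (intro exI[of _ "\<X> x v"] conjI ballI \<X> refl)
  qed (use T L M small G_lip G_second in \<open>auto intro!: flow_force_diff[of T] flow_force_bound continuous_on_diff\<close>)
  have "ham_flow_pos G T x v = \<X> x v T" for x v
    unfolding ham_flow_pos_def flow_ode_iff[OF T G]
  \<comment> \<open>The definite description needs a unique endpoint, not a unique function:
    \<open>X\<close> is arbitrary outside \<open>{0..T}\<close>. Uniqueness is
    \<open>traj_stable\<close> with equal data.\<close>
  proof (rule the_equality)
    show "\<exists>X. continuous_on {0..T} X \<and> (\<forall>t\<in>{0..T}. X t = x + t *\<^sub>R v - flow_force t (\<lambda>s. G (X s))) \<and> \<X> x v T = X T"
      by (intro exI[of _ "\<X> x v"] conjI ballI \<X> refl)
    fix y assume "\<exists>X. continuous_on {0..T} X \<and> (\<forall>t\<in>{0..T}. X t = x + t *\<^sub>R v - flow_force t (\<lambda>s. G (X s))) \<and> y = X T"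
    then obtain X where X: "traj x v X" "y = X T" by (auto simp: traj_def)
    have "traj x v (\<X> x v)" unfolding traj_def by (intro conjI ballI \<X>)
    from traj_stable[OF X(1) this, of T] show "y = \<X> x v T" using T X(2) by simp
  qed
  then have "ham_flow_pos G T = (\<lambda>x v. \<X> x v T)" by (intro ext)
  then show ?thesis using coupled_maps by simp
qed

section \<open>A Harnack inequality\<close>

lemma Young_powr:
  fixes a b q :: real
  assumes q: "q > 1" and a: "a \<ge> 0" and b: "b \<ge> 0"
  shows "a powr (q - 1) * b \<le> (1 - 1 / q) * a powr q + b powr q / q"
proof -
  define p where "p = q / (q - 1)"
  have p: "p > 1" "1 / p + 1 / q = 1" "1 / p = 1 - 1 / q" "(q - 1) * p = q"
    using q by (auto simp: p_def field_simps)
  have "a powr (q - 1) * b \<le> (a powr (q - 1)) powr p / p + b powr q / q"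
    by (rule Youngs_inequality) (use p q a b in auto)
  also have "(a powr (q - 1)) powr p = a powr q" using a p by (simp add: powr_powr)
  also have "a powr q / p = (1 - 1 / q) * a powr q" using p(3) by (simp add: divide_inverse mult.commute)
  finally show ?thesis .
qed

context coupled_maps
begin

definition kernel :: "'a measure \<Rightarrow> 'a measure" where
  "kernel \<rho> = distr (\<rho> \<Otimes>\<^sub>M std_gauss) borel (\<lambda>(x, v). F x v)"

lemma measurable_F [measurable]: "F x \<in> borel_measurable borel"
proof -
  have "continuous_on UNIV (\<lambda>v. F (fst (x, v)) (snd (x, v)))"
    by (rule continuous_on_compose2[OF continuous]) (auto intro!: continuous_intros)
  then show ?thesis by (simp add: borel_measurable_continuous_onI)
qed

lemma measurable_F_pair [measurable]: "(\<lambda>(x, v). F x v) \<in> borel \<Otimes>\<^sub>M borel \<rightarrow>\<^sub>M borel"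
  using borel_measurable_continuous_onI[OF continuous] by (simp add: borel_prod case_prod_unfold)

lemma measurable_inv_F [measurable]: "inv (F x) \<in> borel_measurable borel"
proof -
  obtain c where c: "c > 0" "\<And>v u. norm (v - u) \<le> c * norm (F x v - F x u)"
    using expanding[of x] by auto
  have "norm (inv (F x) z - inv (F x) w) \<le> c * norm (z - w)" for z w
    using c(2)[of "inv (F x) z" "inv (F x) w"] by (simp add: surj_f_inv_f[OF surj])
  then have "continuous_on UNIV (inv (F x))"
    by (intro lipschitz_on_continuous_on[of c] lipschitz_onI) (use c in \<open>auto simp: dist_norm\<close>)
  then show ?thesis by (rule borel_measurable_continuous_onI)
qed

lemma nn_integral_std_gauss:
  fixes \<phi> :: "'a \<Rightarrow> ennreal"
  assumes [measurable]: "\<phi> \<in> borel_measurable borel"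
  shows "(\<integral>\<^sup>+v. \<phi> v \<partial>std_gauss) = (\<integral>\<^sup>+v. ennreal ((2 * pi) powr (- real DIM('a) / 2) * exp (- ((norm v)\<^sup>2 / 2))) * \<phi> v \<partial>lborel)"
  unfolding std_gauss_def by (rule nn_integral_density) auto

text \<open>The velocity \<open>\<Phi> v\<close> at \<open>y\<close> leads to the same endpoint as
  \<open>v\<close> at \<open>x\<close>, and Young's inequality is applied to the ratio of the Gaussian weights of \<open>v\<close> and
  \<open>\<Phi> v\<close>.\<close>
lemma harnack:
  fixes \<psi> :: "'a \<Rightarrow> real" and q :: real and x y :: 'a
  assumes q: "q > 1" and [measurable]: "\<psi> \<in> borel_measurable borel" and \<psi>: "\<And>z. \<psi> z \<ge> 0"
  defines "r \<equiv> norm (x - y)" and "d \<equiv> real DIM('a)"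
  shows "(\<integral>\<^sup>+v. ennreal (\<psi> (F x v) powr (q - 1)) \<partial>std_gauss)
    \<le> ennreal (exp ((q - 1) * (8 * d * M * T\<^sup>2 + 3 * sqrt d / (2 * T)) * r + 9 * q * (q - 1) / (8 * T\<^sup>2) * r\<^sup>2) / q)
      + ennreal (1 - 1 / q) * (\<integral>\<^sup>+u. ennreal (\<psi> (F y u) powr q) \<partial>std_gauss)"
proof -
  define \<Phi> where "\<Phi> v = inv (F y) (F x v)" for v
  have \<Phi>: "F x v = F y (\<Phi> v)" for v by (simp add: \<Phi>_def surj_f_inv_f[OF surj])
  have [measurable]: "\<Phi> \<in> borel_measurable borel" unfolding \<Phi>_def[abs_def] by measurable
  have surj\<Phi>: "surj \<Phi>"
  proof (rule surjI)
    show "\<Phi> (inv (F x) (F y u)) = u" for u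
      by (simp add: \<Phi>_def surj_f_inv_f[OF surj] inv_f_f[OF inj])
  qed
  define K where "K = exp (8 * M * T\<^sup>2 * r)"
  \<comment> \<open>\<open>K\<close> is a Lipschitz constant of the inverse of \<Phi>, so \<kappa>
    bounds how strongly \<Phi> compresses volume.\<close>
  define \<kappa> where "\<kappa> = K ^ DIM('a)"
  have K: "K > 0" and \<kappa>: "\<kappa> > 0" by (simp_all add: K_def \<kappa>_def)
  have \<kappa>_exp: "\<kappa> = exp (8 * d * M * T\<^sup>2 * r)"
    by (simp add: \<kappa>_def K_def d_def exp_of_nat_mult[symmetric] mult_ac)
  define a where "a = 3 / (2 * T) * r"
  have a: "a \<ge> 0" using T by (simp add: a_def r_def)
  define \<gamma> where "\<gamma> v = (2 * pi) powr (- d / 2) * exp (- ((norm v)\<^sup>2 / 2))" for v :: 'a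
  have \<gamma>: "\<gamma> v > 0" for v by (simp add: \<gamma>_def)
  have [measurable]: "\<gamma> \<in> borel_measurable borel" unfolding \<gamma>_def[abs_def] by measurable
  \<comment> \<open>The ratio of the weight at \<open>v\<close> to the transported weight
    \<open>\<gamma> (\<Phi> v) / \<kappa>\<close>. Against the latter, the first Young term
    integrates to at most \<open>1 - 1 / q\<close> times the integral at \<open>y\<close>.\<close>
  define s where "s v = \<kappa> * (\<gamma> v / \<gamma> (\<Phi> v))" for v
  have s: "s v > 0" for v using \<kappa> \<gamma> by (simp add: s_def)
  have s_le: "s v \<le> exp (8 * d * M * T\<^sup>2 * r + a * norm v + a\<^sup>2 / 2)" for v
  proof -
    have "norm (v - \<Phi> v) \<le> a" using coupling[OF \<Phi>] by (simp add: a_def r_def)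
    then have "norm (\<Phi> v) \<le> norm v + a" using norm_triangle_sub[of "\<Phi> v" v] by (simp add: norm_minus_commute)
    then have "(norm (\<Phi> v))\<^sup>2 \<le> (norm v + a)\<^sup>2" by (rule power_mono) simp
    then have "(norm (\<Phi> v))\<^sup>2 / 2 - (norm v)\<^sup>2 / 2 \<le> a * norm v + a\<^sup>2 / 2"
      unfolding power2_sum by (simp add: field_simps)
    moreover have "\<gamma> v / \<gamma> (\<Phi> v) = exp ((norm (\<Phi> v))\<^sup>2 / 2 - (norm v)\<^sup>2 / 2)"
      unfolding exp_diff by (simp add: \<gamma>_def exp_minus field_simps)
    ultimately show ?thesis unfolding s_def \<kappa>_exp
      by (simp add: exp_add[symmetric])
  qed
  define C where "C = exp ((q - 1) * (8 * d * M * T\<^sup>2 * r + a\<^sup>2 / 2)) / q"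
  have pointwise: "\<gamma> v * \<psi> (F x v) powr (q - 1)
    \<le> (1 - 1 / q) / \<kappa> * (\<gamma> (\<Phi> v) * \<psi> (F y (\<Phi> v)) powr q) + C * (\<gamma> v * exp ((q - 1) * a * norm v))" for v
  proof -
    have "\<psi> (F x v) powr (q - 1) * s v \<le> (1 - 1 / q) * \<psi> (F x v) powr q + s v powr q / q"
      by (rule Young_powr[OF q \<psi> less_imp_le[OF s]])
    \<comment> \<open>One factor \<open>s v\<close> is kept exact: times the transported weight it
      restores \<open>\<gamma> v\<close>, leaving an expectation under the standard Gaussian. Only
      the power \<open>q - 1\<close> is estimated.\<close>
    also have "s v powr q = s v powr (q - 1) * s v"
      using s[of v] by (simp add: powr_diff)
    also have "\<dots> / q \<le> exp ((q - 1) * (8 * d * M * T\<^sup>2 * r + a * norm v + a\<^sup>2 / 2)) * s v / q"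
    proof -
      have "s v powr (q - 1) \<le> exp (8 * d * M * T\<^sup>2 * r + a * norm v + a\<^sup>2 / 2) powr (q - 1)"
        using s_le[of v] s[of v] q by (intro powr_mono2) auto
      also have "\<dots> = exp ((q - 1) * (8 * d * M * T\<^sup>2 * r + a * norm v + a\<^sup>2 / 2))"
        by (simp add: powr_def)
      finally show ?thesis using s[of v] q by (intro divide_right_mono mult_right_mono) auto
    qed
    also have "exp ((q - 1) * (8 * d * M * T\<^sup>2 * r + a * norm v + a\<^sup>2 / 2)) * s v / q
       = C * exp ((q - 1) * a * norm v) * s v"
      unfolding C_def by (simp add: exp_add[symmetric] algebra_simps)
    finally have le: "\<psi> (F x v) powr (q - 1) * s v * (\<gamma> (\<Phi> v) / \<kappa>)
       \<le> ((1 - 1 / q) * \<psi> (F x v) powr q + C * exp ((q - 1) * a * norm v) * s v) * (\<gamma> (\<Phi> v) / \<kappa>)"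
      using \<kappa> \<gamma>[of "\<Phi> v"] by (intro mult_right_mono) auto
    have \<gamma>_eq: "\<gamma> v = s v * (\<gamma> (\<Phi> v) / \<kappa>)"
      using \<kappa> \<gamma>[of "\<Phi> v"] by (simp add: s_def)
    have "\<gamma> v * \<psi> (F x v) powr (q - 1) = \<psi> (F x v) powr (q - 1) * s v * (\<gamma> (\<Phi> v) / \<kappa>)"
      by (subst \<gamma>_eq) simp
    also note le
    also have "((1 - 1 / q) * \<psi> (F x v) powr q + C * exp ((q - 1) * a * norm v) * s v) * (\<gamma> (\<Phi> v) / \<kappa>)
       = (1 - 1 / q) / \<kappa> * (\<gamma> (\<Phi> v) * \<psi> (F x v) powr q)
         + C * (s v * (\<gamma> (\<Phi> v) / \<kappa>) * exp ((q - 1) * a * norm v))"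
    proof -
      have "(A * p + C * e * s) * (g / k) = A / k * (g * p) + C * (s * (g / k) * e)" for A p C e s g k :: real
        by (simp add: divide_inverse algebra_simps)
      then show ?thesis .
    qed
    finally show ?thesis unfolding \<gamma>_eq[symmetric] \<Phi>[symmetric] .
  qed
  let ?I = "\<integral>\<^sup>+u. ennreal (\<psi> (F y u) powr q) \<partial>std_gauss"
  have C0: "C \<ge> 0" using q by (simp add: C_def)
  have q1: "(1 - 1 / q) / \<kappa> \<ge> 0" using q \<kappa> by simp
  have "(\<integral>\<^sup>+v. ennreal (\<psi> (F x v) powr (q - 1)) \<partial>std_gauss)
    = (\<integral>\<^sup>+v. ennreal (\<gamma> v * \<psi> (F x v) powr (q - 1)) \<partial>lborel)"
    by (subst nn_integral_std_gauss) (auto simp: \<gamma>_def d_def ennreal_mult'[symmetric])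
  also have "\<dots> \<le> (\<integral>\<^sup>+v. ennreal ((1 - 1 / q) / \<kappa>) * ennreal (\<gamma> (\<Phi> v) * \<psi> (F y (\<Phi> v)) powr q)
      + ennreal C * ennreal (\<gamma> v * exp ((q - 1) * a * norm v)) \<partial>lborel)"
  proof (rule nn_integral_mono)
    fix v
    let ?X = "\<gamma> (\<Phi> v) * \<psi> (F y (\<Phi> v)) powr q" and ?Y = "\<gamma> v * exp ((q - 1) * a * norm v)"
    have "0 \<le> ?X" "0 \<le> ?Y" using \<gamma> by (simp_all add: less_imp_le)
    then have "ennreal ((1 - 1 / q) / \<kappa>) * ennreal ?X + ennreal C * ennreal ?Y
      = ennreal ((1 - 1 / q) / \<kappa> * ?X + C * ?Y)"
      using q1 C0 by (subst ennreal_plus) (simp_all only: ennreal_mult mult_nonneg_nonneg)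
    then show "ennreal (\<gamma> v * \<psi> (F x v) powr (q - 1))
      \<le> ennreal ((1 - 1 / q) / \<kappa>) * ennreal ?X + ennreal C * ennreal ?Y"
      using pointwise[of v] by (simp only: ennreal_leI)
  qed
  also have "\<dots> = ennreal ((1 - 1 / q) / \<kappa>) * (\<integral>\<^sup>+v. ennreal (\<gamma> (\<Phi> v) * \<psi> (F y (\<Phi> v)) powr q) \<partial>lborel)
      + ennreal C * (\<integral>\<^sup>+v. ennreal (\<gamma> v * exp ((q - 1) * a * norm v)) \<partial>lborel)"
    by (simp add: nn_integral_add nn_integral_cmult)
  also have "(\<integral>\<^sup>+v. ennreal (\<gamma> v * exp ((q - 1) * a * norm v)) \<partial>lborel)
    = (\<integral>\<^sup>+v. ennreal (exp ((q - 1) * a * norm v)) \<partial>(std_gauss :: 'a measure))"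
    by (subst nn_integral_std_gauss) (auto simp: \<gamma>_def d_def ennreal_mult'[symmetric])
  also have "ennreal ((1 - 1 / q) / \<kappa>) * (\<integral>\<^sup>+v. ennreal (\<gamma> (\<Phi> v) * \<psi> (F y (\<Phi> v)) powr q) \<partial>lborel)
    \<le> ennreal (1 - 1 / q) * ?I"
  proof -
    have "(\<integral>\<^sup>+v. ennreal (\<gamma> (\<Phi> v) * \<psi> (F y (\<Phi> v)) powr q) \<partial>lborel)
       \<le> ennreal (K ^ DIM('a)) * (\<integral>\<^sup>+u. ennreal (\<gamma> u * \<psi> (F y u) powr q) \<partial>lborel)"
    proof (rule nn_integral_expanding_map[OF _ K surj\<Phi>])
      show "norm (v - w) \<le> K * norm (\<Phi> v - \<Phi> w)" for v w
        using coupling_expanding[OF \<Phi> \<Phi>] by (simp add: K_def r_def)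
    qed auto
    also have "(\<integral>\<^sup>+u. ennreal (\<gamma> u * \<psi> (F y u) powr q) \<partial>lborel) = ?I"
      by (subst nn_integral_std_gauss) (auto simp: \<gamma>_def d_def ennreal_mult'[symmetric])
    finally have "ennreal ((1 - 1 / q) / \<kappa>) * (\<integral>\<^sup>+v. ennreal (\<gamma> (\<Phi> v) * \<psi> (F y (\<Phi> v)) powr q) \<partial>lborel)
       \<le> ennreal ((1 - 1 / q) / \<kappa>) * (ennreal \<kappa> * ?I)"
      unfolding \<kappa>_def by (rule mult_left_mono) simp
    also have "\<dots> = ennreal (1 - 1 / q) * ?I"
      using q1 \<kappa> by (simp add: mult.assoc[symmetric] ennreal_mult'[symmetric])
    finally show ?thesis .
  qed
  also have "ennreal C * (\<integral>\<^sup>+v. ennreal (exp ((q - 1) * a * norm v)) \<partial>(std_gauss :: 'a measure))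
    \<le> ennreal C * ennreal (exp ((q - 1) * a * sqrt d + ((q - 1) * a)\<^sup>2 / 2))"
    unfolding d_def using a q by (intro mult_left_mono std_gauss_exp_norm) auto
  also have "\<dots> = ennreal (exp ((q - 1) * (8 * d * M * T\<^sup>2 + 3 * sqrt d / (2 * T)) * r
      + 9 * q * (q - 1) / (8 * T\<^sup>2) * r\<^sup>2) / q)"
  proof -
    \<comment> \<open>\<open>(q - 1) / 2\<close> from the weights and
      \<open>(q - 1)\<^sup>2 / 2\<close> from the Gaussian moment add up to
      \<open>q * (q - 1) / 2\<close>; inserting \<open>a = 3 / (2 * T) * r\<close> gives
      \<delta>2.\<close>
    have "(q - 1) * (a\<^sup>2 / 2) + ((q - 1) * a)\<^sup>2 / 2 = q * (q - 1) * a\<^sup>2 / 2"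
      by (simp add: power2_eq_square field_simps)
    also have "\<dots> = 9 * q * (q - 1) / (8 * T\<^sup>2) * r\<^sup>2"
      using T by (simp add: a_def power_mult_distrib power_divide)
    finally have 1: "(q - 1) * (a\<^sup>2 / 2) + ((q - 1) * a)\<^sup>2 / 2 = 9 * q * (q - 1) / (8 * T\<^sup>2) * r\<^sup>2" .
    have 2: "(q - 1) * (8 * d * M * T\<^sup>2 + 3 * sqrt d / (2 * T)) * r
        = (q - 1) * (8 * d * M * T\<^sup>2 * r) + (q - 1) * a * sqrt d"
      by (simp add: a_def algebra_simps)
    have "(q - 1) * (8 * d * M * T\<^sup>2 * r + a\<^sup>2 / 2) + ((q - 1) * a * sqrt d + ((q - 1) * a)\<^sup>2 / 2)
      = (q - 1) * (8 * d * M * T\<^sup>2 + 3 * sqrt d / (2 * T)) * r + 9 * q * (q - 1) / (8 * T\<^sup>2) * r\<^sup>2"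
      using 1 2 distrib_left[of "q - 1" "8 * d * M * T\<^sup>2 * r" "a\<^sup>2 / 2"] by linarith
    then show ?thesis using q unfolding C_def
      by (simp add: ennreal_mult'[symmetric] exp_add[symmetric])
  qed
  finally show ?thesis by (simp add: add.commute add_left_mono add_right_mono)
qed

lemma prob_borel_kernel:
  assumes "prob_borel \<rho>"
  shows "prob_borel (kernel \<rho>)"
proof -
  interpret R: prob_space \<rho> using assms by (simp add: prob_borel_def)
  interpret N: prob_space "std_gauss :: 'a measure" by (rule prob_space_std_gauss)
  interpret P: pair_prob_space \<rho> "std_gauss :: 'a measure" ..
  have [measurable_cong]: "sets \<rho> = sets borel" using assms by (simp add: prob_borel_def)
  show ?thesis unfolding prob_borel_def kernel_def
    by (auto intro!: P.prob_space_distr)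
qed

lemma nn_integral_kernel:
  assumes "prob_borel \<rho>" and [measurable]: "\<phi> \<in> borel_measurable borel"
  shows "(\<integral>\<^sup>+z. \<phi> z \<partial>kernel \<rho>) = (\<integral>\<^sup>+x. (\<integral>\<^sup>+v. \<phi> (F x v) \<partial>std_gauss) \<partial>\<rho>)"
proof -
  interpret R: prob_space \<rho> using assms by (simp add: prob_borel_def)
  interpret N: prob_space "std_gauss :: 'a measure" by (rule prob_space_std_gauss)
  have [measurable_cong]: "sets \<rho> = sets borel" using assms by (simp add: prob_borel_def)
  have "(\<integral>\<^sup>+z. \<phi> z \<partial>kernel \<rho>) = (\<integral>\<^sup>+p. \<phi> (case p of (x, v) \<Rightarrow> F x v) \<partial>(\<rho> \<Otimes>\<^sub>M std_gauss))"
    unfolding kernel_def by (rule nn_integral_distr) auto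
  also have "\<dots> = (\<integral>\<^sup>+x. (\<integral>\<^sup>+v. \<phi> (F x v) \<partial>std_gauss) \<partial>\<rho>)"
    by (subst N.nn_integral_fst[symmetric]) auto
  finally show ?thesis .
qed

text \<open>The right side of \<open>harnack\<close> is a term in \<open>norm (x - y)\<close> plus a
  term in \<open>y\<close> alone, so only the second marginal matters for the latter. A product
  bound of Hoelder type would not separate in this way.\<close>

lemma harnack_coupling:
  fixes \<psi> :: "'a \<Rightarrow> real" and q :: real and \<pi> :: "('a \<times> 'a) measure"
  assumes q: "q > 1" and [measurable]: "\<psi> \<in> borel_measurable borel" and \<psi>: "\<And>z. \<psi> z \<ge> 0"
    and \<pi>: "coupling \<pi> \<rho> \<nu>"
  defines "d \<equiv> real DIM('a)"
  defines "\<delta>1 \<equiv> (q - 1) * (8 * d * M * T\<^sup>2 + 3 * sqrt d / (2 * T))" and "\<delta>2 \<equiv> 9 * q * (q - 1) / (8 * T\<^sup>2)"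
  shows "(\<integral>\<^sup>+z. ennreal (\<psi> z powr (q - 1)) \<partial>kernel \<rho>)
    \<le> ennreal (1 / q) * (\<integral>\<^sup>+p. ennreal (exp (\<delta>1 * norm (fst p - snd p) + \<delta>2 * (norm (fst p - snd p))\<^sup>2)) \<partial>\<pi>)
      + ennreal (1 - 1 / q) * (\<integral>\<^sup>+z. ennreal (\<psi> z powr q) \<partial>kernel \<nu>)"
proof -
  interpret P: prob_space \<pi> using \<pi> by (simp add: coupling_def)
  interpret N: prob_space "std_gauss :: 'a measure" by (rule prob_space_std_gauss)
  have [measurable_cong]: "sets \<pi> = sets (borel \<Otimes>\<^sub>M borel)" using \<pi> by (simp add: coupling_def)
  have \<rho>: "\<rho> = distr \<pi> borel fst" and \<nu>: "\<nu> = distr \<pi> borel snd" using \<pi> by (auto simp: coupling_def)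
  have pb: "prob_borel \<rho>" "prob_borel \<nu>"
    unfolding prob_borel_def \<rho> \<nu> by (auto intro!: P.prob_space_distr)
  have [measurable]: "(\<lambda>x. \<integral>\<^sup>+v. ennreal (\<psi> (F x v) powr c) \<partial>std_gauss) \<in> borel_measurable borel" for c
    by measurable
  have "(\<integral>\<^sup>+z. ennreal (\<psi> z powr (q - 1)) \<partial>kernel \<rho>)
    = (\<integral>\<^sup>+p. (\<integral>\<^sup>+v. ennreal (\<psi> (F (fst p) v) powr (q - 1)) \<partial>std_gauss) \<partial>\<pi>)"
    by (simp add: nn_integral_kernel pb) (simp add: \<rho> nn_integral_distr)
  also have "\<dots> \<le> (\<integral>\<^sup>+p. ennreal (1 / q) * ennreal (exp (\<delta>1 * norm (fst p - snd p) + \<delta>2 * (norm (fst p - snd p))\<^sup>2))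
      + ennreal (1 - 1 / q) * (\<integral>\<^sup>+v. ennreal (\<psi> (F (snd p) v) powr q) \<partial>std_gauss) \<partial>\<pi>)"
  proof (rule nn_integral_mono)
    fix p :: "'a \<times> 'a"
    have "ennreal (exp (\<delta>1 * norm (fst p - snd p) + \<delta>2 * (norm (fst p - snd p))\<^sup>2) / q)
      = ennreal (1 / q) * ennreal (exp (\<delta>1 * norm (fst p - snd p) + \<delta>2 * (norm (fst p - snd p))\<^sup>2))"
      using q by (simp add: ennreal_mult'[symmetric])
    then show "(\<integral>\<^sup>+v. ennreal (\<psi> (F (fst p) v) powr (q - 1)) \<partial>std_gauss)
      \<le> ennreal (1 / q) * ennreal (exp (\<delta>1 * norm (fst p - snd p) + \<delta>2 * (norm (fst p - snd p))\<^sup>2))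
      + ennreal (1 - 1 / q) * (\<integral>\<^sup>+v. ennreal (\<psi> (F (snd p) v) powr q) \<partial>std_gauss)"
      using harnack[OF assms(1-3), where x = "fst p" and y = "snd p"] unfolding \<delta>1_def \<delta>2_def d_def by simp
  qed
  also have "\<dots> = ennreal (1 / q) * (\<integral>\<^sup>+p. ennreal (exp (\<delta>1 * norm (fst p - snd p) + \<delta>2 * (norm (fst p - snd p))\<^sup>2)) \<partial>\<pi>)
      + ennreal (1 - 1 / q) * (\<integral>\<^sup>+p. (\<integral>\<^sup>+v. ennreal (\<psi> (F (snd p) v) powr q) \<partial>std_gauss) \<partial>\<pi>)"
    by (simp add: nn_integral_add nn_integral_cmult)
  also have "(\<integral>\<^sup>+p. (\<integral>\<^sup>+v. ennreal (\<psi> (F (snd p) v) powr q) \<partial>std_gauss) \<partial>\<pi>) = (\<integral>\<^sup>+z. ennreal (\<psi> z powr q) \<partial>kernel \<nu>)"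
    by (simp add: nn_integral_kernel pb) (simp add: \<nu> nn_integral_distr)
  finally show ?thesis .
qed

end

section \<open>From the dual inequality to the Renyi divergence\<close>

text \<open>The hypothesis is the dual (Young) form of a bound on the \<open>q\<close>-th moment of the density; it is
  tested with truncations of the density itself.\<close>
lemma renyi_le_dual:
  fixes P \<nu> :: "'a::euclidean_space measure" and q B :: real
  assumes q: "q > 1" and P: "prob_borel P" and \<nu>: "prob_borel \<nu>" and B: "B \<ge> 0" and A: "A \<le> ennreal (exp B)"
    and dual: "\<And>\<psi>. \<psi> \<in> borel_measurable borel \<Longrightarrow> (\<And>z. \<psi> z \<ge> (0::real)) \<Longrightarrow>
      (\<integral>\<^sup>+z. ennreal (\<psi> z powr (q - 1)) \<partial>P)
        \<le> ennreal (1 / q) * A + ennreal (1 - 1 / q) * (\<integral>\<^sup>+z. ennreal (\<psi> z powr q) \<partial>\<nu>)"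
  shows "renyi q P \<nu> \<le> ereal (B / (q - 1))"
proof -
  interpret P: prob_space P using P by (simp add: prob_borel_def)
  interpret N: prob_space \<nu> using \<nu> by (simp add: prob_borel_def)
  have [measurable_cong]: "sets P = sets borel" "sets \<nu> = sets borel"
    using P \<nu> by (auto simp: prob_borel_def)
  have sets_eq: "sets P = sets \<nu>" using P \<nu> by (simp add: prob_borel_def)
  obtain \<alpha> where \<alpha>: "A = ennreal \<alpha>" "\<alpha> \<ge> 0"
    using A by (cases A) (auto simp: top_unique)
  have ac: "absolutely_continuous \<nu> P"
    unfolding absolutely_continuous_def
  proof
    fix S assume S: "S \<in> null_sets \<nu>"
    then have Sb [measurable]: "S \<in> sets borel" using \<nu> by (auto simp: prob_borel_def null_sets_def)
    have bound: "ennreal c * emeasure P S \<le> ennreal (\<alpha> / q)" if c: "c > 0" for c :: real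
    proof -
      \<comment> \<open>\<open>\<psi> z powr (q - 1)\<close> is \<open>c\<close> times the indicator
        of a \<nu>-null set, so the \<nu>-integral vanishes; as \<open>c\<close> is arbitrary,
        \<open>S\<close> must be null for \<open>P\<close>.\<close>
      define \<psi> where "\<psi> z = c powr (1 / (q - 1)) * indicator S z" for z :: 'a
      have [measurable]: "\<psi> \<in> borel_measurable borel" unfolding \<psi>_def[abs_def] by measurable
      have p: "\<psi> z powr (q - 1) = c * indicator S z" for z
        using c q by (auto simp: \<psi>_def powr_powr split: split_indicator)
      have "ennreal c * emeasure P S = (\<integral>\<^sup>+z. ennreal (\<psi> z powr (q - 1)) \<partial>P)"
        unfolding p using c by (simp add: ennreal_mult' ennreal_indicator nn_integral_cmult)
      also have "\<dots> \<le> ennreal (1 / q) * A + ennreal (1 - 1 / q) * (\<integral>\<^sup>+z. ennreal (\<psi> z powr q) \<partial>\<nu>)"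
        by (rule dual) (auto simp: \<psi>_def)
      also have "(\<integral>\<^sup>+z. ennreal (\<psi> z powr q) \<partial>\<nu>) = (\<integral>\<^sup>+z. 0 \<partial>\<nu>)"
      proof (rule nn_integral_cong_AE)
        show "AE z in \<nu>. ennreal (\<psi> z powr q) = 0"
          using AE_not_in[OF S] by eventually_elim (simp add: \<psi>_def)
      qed
      finally show ?thesis using \<alpha> q by (simp add: ennreal_mult'[symmetric])
    qed
    have "measure P S = 0"
    proof (rule ccontr)
      assume "measure P S \<noteq> 0"
      then have m: "measure P S > 0" by (simp add: zero_less_measure_iff)
      define c where "c = (\<alpha> / q + 1) / measure P S"
      have c: "c > 0" using m \<alpha> q by (simp add: c_def add_nonneg_pos)
      have "ennreal (c * measure P S) \<le> ennreal (\<alpha> / q)"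
        using bound[OF c] c by (simp add: P.emeasure_eq_measure ennreal_mult')
      then have "c * measure P S \<le> \<alpha> / q" using \<alpha> q by (simp add: ennreal_le_iff)
      then show False using m by (simp add: c_def)
    qed
    then show "S \<in> null_sets P" using S sets_eq by (auto simp: null_sets_def P.emeasure_eq_measure)
  qed
  define r where "r z = enn2real (RN_deriv \<nu> P z)" for z
  have [measurable]: "r \<in> borel_measurable borel" unfolding r_def[abs_def] by measurable
  have r0: "r z \<ge> 0" for z by (simp add: r_def)
  have dens: "density \<nu> (RN_deriv \<nu> P) = P" by (rule N.density_RN_deriv[OF ac sets_eq])
  \<comment> \<open>\<open>enn2real\<close> sends infinity to 0, so \<open>r\<close> represents the
    density only because the latter is finite almost everywhere.\<close>
  have fin: "AE z in \<nu>. RN_deriv \<nu> P z = ennreal (r z)"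
  proof -
    have "AE z in \<nu>. RN_deriv \<nu> P z \<noteq> \<infinity>"
      by (rule N.RN_deriv_finite[OF P.sigma_finite_measure_axioms ac sets_eq])
    then show ?thesis by eventually_elim (simp add: r_def less_top)
  qed
  \<comment> \<open>Truncation makes \<open>Z n\<close> finite, so its share
    \<open>1 - 1 / q\<close> on the right can be subtracted. Both sides then carry the same factor
    \<open>1 / q\<close>, and Young's inequality costs nothing.\<close>
  define Z where "Z n = (\<integral>\<^sup>+z. ennreal (min (r z) (real n) powr q) \<partial>\<nu>)" for n :: nat
  have Z: "Z n \<le> A" for n
  proof -
    let ?\<psi> = "\<lambda>z. min (r z) (real n)"
    have "Z n \<le> (\<integral>\<^sup>+z. ennreal (real n powr q) \<partial>\<nu>)"
      unfolding Z_def using r0 q by (intro nn_integral_mono ennreal_leI powr_mono2) auto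
    also have "\<dots> < \<infinity>" by (simp add: N.emeasure_space_1)
    finally obtain \<zeta> where \<zeta>: "Z n = ennreal \<zeta>" "\<zeta> \<ge> 0" by (cases "Z n") auto
    have "Z n \<le> (\<integral>\<^sup>+z. RN_deriv \<nu> P z * ennreal (?\<psi> z powr (q - 1)) \<partial>\<nu>)"
      unfolding Z_def
    proof (rule nn_integral_mono_AE, use fin in eventually_elim)
      fix z assume z: "RN_deriv \<nu> P z = ennreal (r z)"
      have "?\<psi> z powr q = ?\<psi> z * ?\<psi> z powr (q - 1)"
        using r0[of z] powr_mult_base[of "?\<psi> z" "q - 1"] by simp
      also have "\<dots> \<le> r z * ?\<psi> z powr (q - 1)" by (intro mult_right_mono) auto
      finally show "ennreal (?\<psi> z powr q) \<le> RN_deriv \<nu> P z * ennreal (?\<psi> z powr (q - 1))"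
        unfolding z using r0[of z] by (simp add: ennreal_mult'[symmetric] ennreal_leI)
    qed
    also have "\<dots> = (\<integral>\<^sup>+z. ennreal (?\<psi> z powr (q - 1)) \<partial>density \<nu> (RN_deriv \<nu> P))"
      by (subst nn_integral_density) auto
    also have "\<dots> = (\<integral>\<^sup>+z. ennreal (?\<psi> z powr (q - 1)) \<partial>P)" unfolding dens ..
    also have "\<dots> \<le> ennreal (1 / q) * A + ennreal (1 - 1 / q) * Z n"
      unfolding Z_def using r0 by (intro dual) auto
    also have "\<dots> = ennreal (\<alpha> / q + (1 - 1 / q) * \<zeta>)"
      unfolding \<zeta>(1) \<alpha>(1) using \<alpha>(2) \<zeta>(2) q by (simp add: ennreal_mult'[symmetric] ennreal_plus[symmetric] del: ennreal_plus)
    finally have "\<zeta> \<le> \<alpha> / q + (1 - 1 / q) * \<zeta>"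
      unfolding \<zeta>(1) using \<alpha>(2) \<zeta>(2) q by (subst (asm) ennreal_le_iff) auto
    then have "\<zeta> / q \<le> \<alpha> / q" by (simp add: algebra_simps)
    then show ?thesis unfolding \<zeta>(1) \<alpha>(1) using q by (intro ennreal_leI) (simp add: divide_le_cancel)
  qed
  have "(\<integral>\<^sup>+z. ennreal (r z powr q) \<partial>\<nu>) \<le> (\<integral>\<^sup>+z. (SUP n. ennreal (min (r z) (real n) powr q)) \<partial>\<nu>)"
  proof (rule nn_integral_mono)
    fix z
    obtain n :: nat where "r z \<le> real n" using real_arch_simple by blast
    then have "ennreal (r z powr q) = ennreal (min (r z) (real n) powr q)" by (simp add: min_absorb1)
    also have "\<dots> \<le> (SUP n. ennreal (min (r z) (real n) powr q))" by (rule SUP_upper) simp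
    finally show "ennreal (r z powr q) \<le> (SUP n. ennreal (min (r z) (real n) powr q))" .
  qed
  also have "\<dots> = (SUP n. Z n)"
    unfolding Z_def using r0 q
    by (intro nn_integral_monotone_convergence_SUP)
      (auto simp: incseq_def le_fun_def intro!: ennreal_leI powr_mono2)
  also have "\<dots> \<le> A" using Z by (rule SUP_least)
  also note A
  finally have I: "(\<integral>\<^sup>+z. ennreal (r z powr q) \<partial>\<nu>) \<le> ennreal (exp B)" .
  define J where "J = enn2real (\<integral>\<^sup>+z. ennreal (r z powr q) \<partial>\<nu>)"
  have Ifin: "(\<integral>\<^sup>+z. ennreal (r z powr q) \<partial>\<nu>) \<noteq> \<infinity>" using I by (auto simp: top_unique)
  have "J \<le> exp B" unfolding J_def by (rule enn2real_leI[OF _ I]) simp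
  moreover have "J \<ge> 0" by (simp add: J_def)
  \<comment> \<open>\<open>ln 0 = 0\<close> by convention; in the case \<open>J = 0\<close> the
    bound is \<open>B \<ge> 0\<close>.\<close>
  ultimately have "ln J \<le> B"
    using B ln_le_cancel_iff[of J "exp B"] by (cases "J = 0") auto
  then show ?thesis
    using ac Ifin q unfolding renyi_def Let_def r_def[symmetric] J_def[symmetric]
    by (simp add: divide_right_mono)
qed

section \<open>Orlicz-Wasserstein distance\<close>

lemma qtil_coupled_maps:
  fixes G :: "'a::euclidean_space \<Rightarrow> 'a" and H :: "'a \<Rightarrow> ('a \<Rightarrow>\<^sub>L 'a)"
  assumes hess: "\<forall>x. (G has_derivative blinfun_apply (H x)) (at x)" and hess_bd: "\<forall>x. norm (H x) \<le> L"
    and third: "\<forall>x. (H has_derivative blinfun_apply (D3 x)) (at x)" and third_bd: "\<forall>x. norm (D3 x) \<le> M"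
    and T: "T > 0" and h: "h \<ge> 0" and T_div: "h = 0 \<or> (\<exists>N::nat. T = real N * h)"
    and small: "L * (T\<^sup>2 + T * h) \<le> 1 / 12"
  shows "coupled_maps (qtil G T h) M T"
proof -
  have L: "L \<ge> 0" using order_trans[OF norm_ge_zero spec[OF hess_bd]] .
  have M: "M \<ge> 0" using order_trans[OF norm_ge_zero spec[OF third_bd]] .
  have "L * T\<^sup>2 \<le> L * (T\<^sup>2 + T * h)" using L T h by (intro mult_left_mono) auto
  then have LT: "L * T\<^sup>2 \<le> 1 / 12" using small by linarith
  note G = lipschitz_of_derivative_bound[OF hess hess_bd] second_difference_bound[OF hess hess_bd third third_bd]
  show ?thesis
  proof (cases "h = 0")
    case True
    then have "qtil G T h = ham_flow_pos G T" by (intro ext) (simp add: qtil_def)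
    then show ?thesis using flow_coupled_maps[OF T L M LT G] by simp
  next
    case False
    then obtain N :: nat where N: "T = real N * h" using T_div by auto
    then have "qtil G T h = (\<lambda>x v. fst ((leapfrog_step G h ^^ N) (x, v)))"
      using False by (intro ext) (simp add: qtil_def)
    then show ?thesis using leapfrog_coupled_maps[OF T N L M LT G] by simp
  qed
qed

text \<open>Here \<open>s\<close> is the weight in \<open>z \<le> s / 2 + z\<^sup>2 / (2 * s)\<close>, and \<open>\<theta> \<le> 1\<close> is needed for the
  concavity of \<open>y \<mapsto> y powr \<theta>\<close>.\<close>
lemma orlicz_exp_bound:
  fixes \<pi> :: "('a::euclidean_space \<times> 'a) measure" and \<delta>1 \<delta>2 l s :: real
  assumes \<pi>: "prob_space \<pi>" and [measurable_cong]: "sets \<pi> = sets (borel \<Otimes>\<^sub>M borel)"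
    and l: "l > 0" and s: "s > 0" and \<delta>: "\<delta>1 \<ge> 0" "\<delta>2 \<ge> 0"
    and orl: "(\<integral>\<^sup>+p. ennreal (exp ((norm (fst p - snd p))\<^sup>2 / l\<^sup>2)) \<partial>\<pi>) \<le> 2"
  defines "\<theta> \<equiv> l\<^sup>2 * (\<delta>1 / (2 * s) + \<delta>2)"
  assumes \<theta>1: "\<theta> \<le> 1"
  shows "(\<integral>\<^sup>+p. ennreal (exp (\<delta>1 * norm (fst p - snd p) + \<delta>2 * (norm (fst p - snd p))\<^sup>2)) \<partial>\<pi>)
    \<le> ennreal (exp (\<delta>1 * s / 2 + \<theta> * ln 2))"
proof -
  interpret prob_space \<pi> by (rule \<pi>)
  have \<theta>0: "\<theta> \<ge> 0" using s \<delta> by (simp add: \<theta>_def)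
  define c where "c = exp (\<delta>1 * s / 2 + \<theta> * ln 2)"
  \<comment> \<open>With \<open>y = exp (z\<^sup>2 / l\<^sup>2) / 2\<close>, whose mean is at most
    1, the tangent inequality \<open>y powr \<theta> \<le> \<theta> * y + 1 - \<theta>\<close> takes
    the place of Jensen's; its integral is at most 1, which leaves \<open>c\<close>.\<close>
  have pointwise: "exp (\<delta>1 * z + \<delta>2 * z\<^sup>2) \<le> c * (\<theta> / 2) * exp (z\<^sup>2 / l\<^sup>2) + c * (1 - \<theta>)" for z :: real
  proof -
    have "2 * z * s \<le> z\<^sup>2 + s\<^sup>2" by (rule sum_squares_bound)
    then have "z \<le> s / 2 + z\<^sup>2 / (2 * s)" using s by (simp add: field_simps power2_eq_square)
    from mult_left_mono[OF this \<delta>(1)]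
    have "\<delta>1 * z + \<delta>2 * z\<^sup>2 \<le> \<delta>1 * s / 2 + (\<delta>1 / (2 * s) + \<delta>2) * z\<^sup>2"
      by (simp add: algebra_simps)
    also have "(\<delta>1 / (2 * s) + \<delta>2) * z\<^sup>2 = \<theta> * (z\<^sup>2 / l\<^sup>2)" using l by (simp add: \<theta>_def)
    finally have "exp (\<delta>1 * z + \<delta>2 * z\<^sup>2) \<le> c * (exp (\<theta> * (z\<^sup>2 / l\<^sup>2)) / exp (\<theta> * ln 2))"
      by (simp add: c_def exp_add[symmetric] exp_diff[symmetric])
    also have "exp (\<theta> * (z\<^sup>2 / l\<^sup>2)) / exp (\<theta> * ln 2) = (exp (z\<^sup>2 / l\<^sup>2) / 2) powr \<theta> * 1 powr (1 - \<theta>)"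
      by (simp add: powr_def ln_div exp_diff[symmetric] right_diff_distrib)
    also have "\<dots> \<le> \<theta> * (exp (z\<^sup>2 / l\<^sup>2) / 2) + (1 - \<theta>) * 1"
      by (rule Youngs_inequality_0) (use \<theta>0 \<theta>1 in auto)
    finally show ?thesis by (simp add: c_def algebra_simps)
  qed
  have c0: "c * (\<theta> / 2) \<ge> 0" "c * (1 - \<theta>) \<ge> 0" using \<theta>0 \<theta>1 by (auto simp: c_def)
  have "(\<integral>\<^sup>+p. ennreal (exp (\<delta>1 * norm (fst p - snd p) + \<delta>2 * (norm (fst p - snd p))\<^sup>2)) \<partial>\<pi>)
    \<le> (\<integral>\<^sup>+p. ennreal (c * (\<theta> / 2)) * ennreal (exp ((norm (fst p - snd p))\<^sup>2 / l\<^sup>2)) + ennreal (c * (1 - \<theta>)) \<partial>\<pi>)"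
  proof (rule nn_integral_mono)
    fix p :: "'a \<times> 'a"
    have "ennreal (c * (\<theta> / 2)) * ennreal (exp ((norm (fst p - snd p))\<^sup>2 / l\<^sup>2)) + ennreal (c * (1 - \<theta>))
      = ennreal (c * (\<theta> / 2) * exp ((norm (fst p - snd p))\<^sup>2 / l\<^sup>2) + c * (1 - \<theta>))"
      using c0 by (subst ennreal_plus) (simp_all only: ennreal_mult mult_nonneg_nonneg exp_ge_zero)
    then show "ennreal (exp (\<delta>1 * norm (fst p - snd p) + \<delta>2 * (norm (fst p - snd p))\<^sup>2))
      \<le> ennreal (c * (\<theta> / 2)) * ennreal (exp ((norm (fst p - snd p))\<^sup>2 / l\<^sup>2)) + ennreal (c * (1 - \<theta>))"
      using pointwise by (simp only: ennreal_leI)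
  qed
  also have "\<dots> = ennreal (c * (\<theta> / 2)) * (\<integral>\<^sup>+p. ennreal (exp ((norm (fst p - snd p))\<^sup>2 / l\<^sup>2)) \<partial>\<pi>) + ennreal (c * (1 - \<theta>))"
    by (simp add: nn_integral_add nn_integral_cmult emeasure_space_1)
  also have "\<dots> \<le> ennreal (c * (\<theta> / 2)) * ennreal 2 + ennreal (c * (1 - \<theta>))"
    using orl by (intro add_right_mono mult_left_mono) auto
  also have "\<dots> = ennreal (c * (\<theta> / 2) * 2 + c * (1 - \<theta>))"
    using c0 by (subst ennreal_plus) (simp_all only: ennreal_mult mult_nonneg_nonneg zero_le_numeral)
  also have "c * (\<theta> / 2) * 2 + c * (1 - \<theta>) = c" by (simp add: algebra_simps)
  finally show ?thesis by (simp add: c_def)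
qed

lemma orlicz_diff_nonneg: "orlicz_diff \<pi> \<ge> 0"
  unfolding orlicz_diff_def by (rule Inf_greatest) auto

lemma W_psi_nonneg: "W_psi \<mu> \<nu> \<ge> 0"
  unfolding W_psi_def by (rule Inf_greatest) (auto simp: orlicz_diff_nonneg)

lemma W_psi_less_coupling:
  assumes "W_psi \<rho> \<nu> < ereal w"
  obtains \<pi> where "coupling \<pi> \<rho> \<nu>" "(\<integral>\<^sup>+z. ennreal (exp ((norm (fst z - snd z))\<^sup>2 / w\<^sup>2)) \<partial>\<pi>) \<le> 2" "w > 0"
proof -
  obtain \<pi> where \<pi>: "coupling \<pi> \<rho> \<nu>" "orlicz_diff \<pi> < ereal w"
    using assms unfolding W_psi_def Inf_less_iff by auto
  then obtain l where l: "l > 0" "l < w" "(\<integral>\<^sup>+z. ennreal (exp ((norm (fst z - snd z))\<^sup>2 / l\<^sup>2)) \<partial>\<pi>) \<le> 2"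
    unfolding orlicz_diff_def Inf_less_iff by auto
  have "l\<^sup>2 \<le> w\<^sup>2" using l by (intro power_mono) auto
  then have "(\<integral>\<^sup>+z. ennreal (exp ((norm (fst z - snd z))\<^sup>2 / w\<^sup>2)) \<partial>\<pi>)
    \<le> (\<integral>\<^sup>+z. ennreal (exp ((norm (fst z - snd z))\<^sup>2 / l\<^sup>2)) \<partial>\<pi>)"
    using l by (intro nn_integral_mono ennreal_leI) (auto intro!: divide_left_mono)
  then show ?thesis using that[of \<pi>] \<pi> l by (meson less_trans order_trans)
qed

text \<open>The infimum defining \<open>W_psi\<close> need not be known to be attained, so the bound is proved for every
  \<open>l > w\<close> and \<open>l\<close> tends to \<open>w\<close>. In the boundary case of \<open>small\<close> the choice \<open>s = sqrt (ln 2) * l\<close> would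
  violate \<open>\<theta> \<le> 1\<close>; there \<open>s\<close> is chosen such that \<open>\<theta> = 1\<close>.\<close>
lemma exp_moment_limit:
  fixes \<delta>1 \<delta>2 w :: real and R :: ereal
  assumes \<delta>: "\<delta>1 > 0" "\<delta>2 > 0" and w: "w \<ge> 0"
    and small: "\<delta>2 * w\<^sup>2 + \<delta>1 * w / (2 * sqrt (ln 2)) \<le> 1"
    and R: "\<And>l s. l > w \<Longrightarrow> s > 0 \<Longrightarrow> l\<^sup>2 * (\<delta>1 / (2 * s) + \<delta>2) \<le> 1 \<Longrightarrow>
      R \<le> ereal (\<delta>1 * s / 2 + l\<^sup>2 * (\<delta>1 / (2 * s) + \<delta>2) * ln 2)"
  shows "R \<le> ereal (\<delta>1 * sqrt (ln 2) * w + \<delta>2 * ln 2 * w\<^sup>2)"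
proof -
  define k where "k = sqrt (ln 2)"
  have k: "k > 0" "k * k = ln 2" by (simp_all add: k_def)
  show ?thesis
  proof (cases "\<delta>2 * w\<^sup>2 + \<delta>1 * w / (2 * k) = 1")
    case False
    let ?F = "\<lambda>l. \<delta>1 * k * l + \<delta>2 * ln 2 * l\<^sup>2"
    let ?g = "\<lambda>l. \<delta>2 * l\<^sup>2 + \<delta>1 * l / (2 * k)"
    have "(?g \<longlongrightarrow> ?g w) (at_right w)" using k by (intro tendsto_intros) auto
    then have ev: "eventually (\<lambda>l. ?g l < 1) (at_right w)"
      by (rule order_tendstoD) (use small False in \<open>simp add: k_def\<close>)
    have "eventually (\<lambda>l. R \<le> ereal (?F l)) (at_right w)"
      using ev eventually_at_right_less
    proof eventually_elim
      case (elim l)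
      have l: "l > 0" using elim w by simp
      \<comment> \<open>\<open>s = k * l\<close> minimises
        \<open>\<delta>1 * s / 2 + l\<^sup>2 * \<delta>1 * ln 2 / (2 * s)\<close>; the condition
        \<theta> \<le> 1 becomes \<open>?g l \<le> 1\<close>, true near \<open>w\<close> because
        \<open>?g w < 1\<close>.\<close>
      have \<theta>: "l\<^sup>2 * (\<delta>1 / (2 * (k * l)) + \<delta>2) = ?g l" using l k by (simp add: field_simps power2_eq_square)
      have "\<delta>1 * (k * l) / 2 + ?g l * (k * k) = ?F l"
        using k(1) unfolding k(2)[symmetric] by (simp add: field_simps power2_eq_square)
      then show ?case using R[of l "k * l"] elim l k unfolding \<theta> by simp
    qed
    moreover have "((\<lambda>l. ereal (?F l)) \<longlongrightarrow> ereal (?F w)) (at_right w)"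
      by (intro tendsto_intros)
    ultimately have "R \<le> ereal (?F w)"
      using tendsto_lowerbound trivial_limit_at_right_real by blast
    then show ?thesis by (simp add: k_def)
  next
    case True
    have w0: "w > 0" using True w by (cases "w = 0") auto
    have one: "1 - \<delta>2 * w\<^sup>2 = \<delta>1 * w / (2 * k)" using True by linarith
    have pos: "1 - \<delta>2 * w\<^sup>2 > 0" unfolding one using \<delta> w0 k by simp
    let ?s = "\<lambda>l. \<delta>1 * l\<^sup>2 / (2 * (1 - \<delta>2 * l\<^sup>2))"
    let ?F = "\<lambda>l. \<delta>1 * ?s l / 2 + ln 2"
    have "((\<lambda>l. 1 - \<delta>2 * l\<^sup>2) \<longlongrightarrow> 1 - \<delta>2 * w\<^sup>2) (at_right w)" by (intro tendsto_intros)
    then have ev: "eventually (\<lambda>l. 0 < 1 - \<delta>2 * l\<^sup>2) (at_right w)"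
      by (rule order_tendstoD) (rule pos)
    have "eventually (\<lambda>l. R \<le> ereal (?F l)) (at_right w)"
      using ev eventually_at_right_less
    proof eventually_elim
      case (elim l)
      have l: "l > 0" using elim w by simp
      have s: "?s l > 0" using l elim \<delta> by simp
      have "\<delta>1 / (2 * (\<delta>1 * l\<^sup>2 / (2 * t))) = t / l\<^sup>2" if "t > 0" for t
        using that l \<delta> by (simp add: field_simps)
      then have "\<delta>1 / (2 * ?s l) = (1 - \<delta>2 * l\<^sup>2) / l\<^sup>2" using elim(1) .
      then have \<theta>: "l\<^sup>2 * (\<delta>1 / (2 * ?s l) + \<delta>2) = 1" using l by (simp add: field_simps)
      show ?case using R[OF elim(2) s] unfolding \<theta> by simp
    qed
    moreover have "((\<lambda>l. ereal (?F l)) \<longlongrightarrow> ereal (?F w)) (at_right w)"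
      using pos by (intro tendsto_intros) auto
    ultimately have "R \<le> ereal (?F w)"
      using tendsto_lowerbound trivial_limit_at_right_real by blast
    \<comment> \<open>At \<open>l = w\<close> the equality \<open>one\<close> returns the minimiser
      \<open>k * w\<close>, so both choices of \<open>s\<close> agree in the limit.\<close>
    also have "?s w = k * w" unfolding one using \<delta> w0 k by (simp add: power2_eq_square)
    also have "\<delta>1 * (k * w) / 2 + ln 2 = \<delta>1 * k * w + \<delta>2 * ln 2 * w\<^sup>2"
    proof -
      have "ln 2 = (k * k) * (\<delta>2 * w\<^sup>2 + \<delta>1 * w / (2 * k))" using True k(2) by simp
      also have "\<dots> = (k * k) * (\<delta>2 * w\<^sup>2) + \<delta>1 * k * w / 2" using k(1) by (simp add: field_simps)
      finally have "\<delta>1 * (k * w) / 2 + ln 2 = \<delta>1 * (k * w) / 2 + (ln 2 * (\<delta>2 * w\<^sup>2) + \<delta>1 * k * w / 2)"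
        unfolding k(2) by (rule arg_cong)
      also have "\<dots> = \<delta>1 * k * w + \<delta>2 * ln 2 * w\<^sup>2" by (simp add: field_simps)
      finally show ?thesis .
    qed
    finally show ?thesis by (simp add: k_def)
  qed
qed

section \<open>Smoothing by one step, and the conclusion\<close>

lemma (in coupled_maps) renyi_kernel_le:
  fixes q w :: real
  assumes q: "q > 1" and \<rho>: "prob_borel \<rho>" and \<nu>: "prob_borel \<nu>" and W: "W_psi \<rho> \<nu> \<le> ereal w"
  defines "d \<equiv> real DIM('a)"
  defines "\<delta>1 \<equiv> (q - 1) * (8 * d * M * T\<^sup>2 + 3 * sqrt d / (2 * T))" and "\<delta>2 \<equiv> 9 * q * (q - 1) / (8 * T\<^sup>2)"
  assumes small: "\<delta>2 * w\<^sup>2 + \<delta>1 * w / (2 * sqrt (ln 2)) \<le> 1"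
  shows "renyi q (kernel \<rho>) (kernel \<nu>) \<le> ereal ((\<delta>1 * sqrt (ln 2) * w + \<delta>2 * ln 2 * w\<^sup>2) / (q - 1))"
proof -
  have d: "d > 0" by (simp add: d_def)
  have \<delta>1: "\<delta>1 > 0" unfolding \<delta>1_def using q M T d by (intro mult_pos_pos add_nonneg_pos) auto
  have \<delta>2: "\<delta>2 > 0" using q T by (simp add: \<delta>2_def)
  have w: "w \<ge> 0" using order_trans[OF W_psi_nonneg W] by simp
  \<comment> \<open>The exponential bound concerns the logarithm of the \<open>q\<close>-th moment,
    hence the factor \<open>q - 1\<close>.\<close>
  have "ereal (q - 1) * renyi q (kernel \<rho>) (kernel \<nu>) \<le> ereal (\<delta>1 * sqrt (ln 2) * w + \<delta>2 * ln 2 * w\<^sup>2)"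
  proof (rule exp_moment_limit[OF \<delta>1 \<delta>2 w small])
    fix l s assume l: "l > w" and s: "s > 0" and \<theta>: "l\<^sup>2 * (\<delta>1 / (2 * s) + \<delta>2) \<le> 1"
    have "W_psi \<rho> \<nu> < ereal l" using W l by (simp add: le_less_trans)
    then obtain \<pi> where \<pi>: "coupling \<pi> \<rho> \<nu>" "l > 0"
      "(\<integral>\<^sup>+z. ennreal (exp ((norm (fst z - snd z))\<^sup>2 / l\<^sup>2)) \<partial>\<pi>) \<le> 2"
      by (rule W_psi_less_coupling)
    let ?B = "\<delta>1 * s / 2 + l\<^sup>2 * (\<delta>1 / (2 * s) + \<delta>2) * ln 2"
    have "renyi q (kernel \<rho>) (kernel \<nu>) \<le> ereal (?B / (q - 1))"
    proof (rule renyi_le_dual[OF q prob_borel_kernel[OF \<rho>] prob_borel_kernel[OF \<nu>]])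
      show "0 \<le> ?B" using \<delta>1 \<delta>2 s by simp
      show "(\<integral>\<^sup>+p. ennreal (exp (\<delta>1 * norm (fst p - snd p) + \<delta>2 * (norm (fst p - snd p))\<^sup>2)) \<partial>\<pi>) \<le> ennreal (exp ?B)"
        using \<pi> \<delta>1 \<delta>2 s \<theta> by (intro orlicz_exp_bound) (auto simp: coupling_def)
    qed (unfold \<delta>1_def \<delta>2_def d_def, rule harnack_coupling[OF q _ _ \<pi>(1)])
    then have "ereal (q - 1) * renyi q (kernel \<rho>) (kernel \<nu>) \<le> ereal (q - 1) * ereal (?B / (q - 1))"
      using q by (intro ereal_mult_left_mono) auto
    then show "ereal (q - 1) * renyi q (kernel \<rho>) (kernel \<nu>) \<le> ereal ?B" using q by simp
  qed
  then show ?thesis using q by (cases "renyi q (kernel \<rho>) (kernel \<nu>)") (auto simp: field_simps)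
qed

text \<open>The condition on \<open>k\<close> is exponentiated so that it also makes sense at the
  extremes: it holds for every \<open>k\<close> if \<open>W_psi \<mu> \<nu>\<close> is 0, where the
  logarithm would be minus infinity, and for none if it is infinite.\<close>

theorem theorem3:
  fixes f :: "'a::euclidean_space \<Rightarrow> real"
    and G :: "'a \<Rightarrow> 'a"
    and H :: "'a \<Rightarrow> ('a \<Rightarrow>\<^sub>L 'a)"
    and D3 :: "'a \<Rightarrow> ('a \<Rightarrow>\<^sub>L 'a \<Rightarrow>\<^sub>L 'a)"
    and L M T h q c1 c2 :: real
    and \<mu> \<nu> :: "'a measure"
  assumes min0: "\<forall>x. f 0 \<le> f x" and f0: "f 0 = 0"
    and grad: "\<forall>x. (f has_derivative (\<lambda>u. G x \<bullet> u)) (at x)"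
    and hess: "\<forall>x. (G has_derivative blinfun_apply (H x)) (at x)"
    and hess_cont: "continuous_on UNIV H"
    and hess_bd: "\<forall>x. norm (H x) \<le> L"
    and third: "\<forall>x. (H has_derivative blinfun_apply (D3 x)) (at x)"
    and third_cont: "continuous_on UNIV D3"
    and third_bd: "\<forall>x. norm (D3 x) \<le> M"
    and T_pos: "T > 0" and h_nonneg: "h \<ge> 0"
    and T_div: "h = 0 \<or> (\<exists>N::nat. T = real N * h)"
    and step_small: "L * (T^2 + T * h) \<le> 1 / 12"
    and mu: "prob_borel \<mu>"
    and nu: "prob_borel \<nu>"
    and stationary: "Ptil G T h \<nu> = \<nu>"
    and c1: "c1 \<ge> 1" and c2: "c2 > 0"
    and contraction: "\<forall>k::nat. k \<ge> 1 \<longrightarrow> (\<forall>\<rho>. prob_borel \<rho> \<longrightarrow>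
        W_psi ((Ptil G T h ^^ k) \<rho>) \<nu> \<le> ereal (c1 * exp (- c2 * real k)) * W_psi \<rho> \<nu>)"
    and q: "1 < q"
  shows "let d = real DIM('a);
             \<delta>1 = (q - 1) * (8 * d * M * T^2 + 3 * sqrt d / (2 * T));
             \<delta>2 = 9 * q * (q - 1) / (8 * T^2)
         in \<forall>k::nat.
              ereal (exp (c2 * real k)) \<ge>
                ereal (c1 / (4 * sqrt (ln 2)) * (\<delta>1 + sqrt (\<delta>1^2 + 16 * ln 2 * \<delta>2))) * W_psi \<mu> \<nu>
              \<longrightarrow> renyi q ((Ptil G T h ^^ (k + 1)) \<mu>) \<nu>
                  \<le> ereal ((\<delta>1 + \<delta>2) / (q - 1) * sqrt (ln 2) * c1^2 * exp (- c2 * real k))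
                    * max 1 ((W_psi \<mu> \<nu>)^2)"
proof -
  interpret C: coupled_maps "qtil G T h" M T
    by (rule qtil_coupled_maps[OF hess hess_bd third third_bd T_pos h_nonneg T_div step_small])
  have Ptil: "Ptil G T h = C.kernel" by (intro ext) (simp add: Ptil_def C.kernel_def)
  define d where "d = real DIM('a)"
  define \<delta>1 where "\<delta>1 = (q - 1) * (8 * d * M * T\<^sup>2 + 3 * sqrt d / (2 * T))"
  define \<delta>2 where "\<delta>2 = 9 * q * (q - 1) / (8 * T\<^sup>2)"
  define k2 where "k2 = sqrt (ln 2)"
  have k2: "k2 > 0" "k2\<^sup>2 = ln 2" by (simp_all add: k2_def)
  have d: "d > 0" by (simp add: d_def)
  have \<delta>1: "\<delta>1 > 0" unfolding \<delta>1_def using q C.M T_pos d by (intro mult_pos_pos add_nonneg_pos) auto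
  have \<delta>2: "\<delta>2 > 0" using q T_pos by (simp add: \<delta>2_def)
  define m where "m = c1 / (4 * k2) * (\<delta>1 + sqrt (\<delta>1\<^sup>2 + 16 * ln 2 * \<delta>2))"
  have m: "m > 0" unfolding m_def using c1 k2 \<delta>1 \<delta>2 by (intro mult_pos_pos add_pos_nonneg) auto
  have main: "renyi q ((Ptil G T h ^^ (k + 1)) \<mu>) \<nu>
      \<le> ereal ((\<delta>1 + \<delta>2) / (q - 1) * k2 * c1\<^sup>2 * exp (- c2 * real k)) * max 1 ((W_psi \<mu> \<nu>)\<^sup>2)"
    if large: "ereal (exp (c2 * real k)) \<ge> ereal m * W_psi \<mu> \<nu>" for k :: nat
  proof -
    have "W_psi \<mu> \<nu> \<noteq> \<infinity>" using large m by auto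
    then obtain W where W: "W_psi \<mu> \<nu> = ereal W" "W \<ge> 0"
      using W_psi_nonneg[of \<mu> \<nu>] by (cases "W_psi \<mu> \<nu>") auto
    define \<epsilon> where "\<epsilon> = exp (- c2 * real k)"
    have \<epsilon>: "0 < \<epsilon>" "\<epsilon> \<le> 1" using c2 by (auto simp: \<epsilon>_def)
    define w where "w = c1 * \<epsilon> * W"
    have w: "w \<ge> 0" using c1 \<epsilon> W by (simp add: w_def)
    have \<rho>: "prob_borel ((Ptil G T h ^^ k) \<mu>)"
      by (induction k) (auto simp: mu Ptil C.prob_borel_kernel)
    have Ww: "W_psi ((Ptil G T h ^^ k) \<mu>) \<nu> \<le> ereal w"
    proof (cases "k = 0")
      case True
      \<comment> \<open>\<open>contraction\<close> starts at 1; for \<open>k = 0\<close> the bound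
        comes from \<open>c1 \<ge> 1\<close>.\<close>
      have "1 * W \<le> c1 * W" using c1 W by (intro mult_right_mono) auto
      then show ?thesis using True W by (simp add: w_def \<epsilon>_def)
    next
      case False
      then have "W_psi ((Ptil G T h ^^ k) \<mu>) \<nu> \<le> ereal (c1 * exp (- c2 * real k)) * W_psi \<mu> \<nu>"
        using contraction mu by simp
      then show ?thesis by (simp add: W w_def \<epsilon>_def)
    qed
    have "m * W \<le> exp (c2 * real k)" using large W by simp
    then have "m * W * \<epsilon> \<le> exp (c2 * real k) * \<epsilon>" using \<epsilon> by (intro mult_right_mono) auto
    then have "m * W * \<epsilon> \<le> 1" by (simp add: \<epsilon>_def exp_minus)
    then have wb: "w * (\<delta>1 + sqrt (\<delta>1\<^sup>2 + 16 * ln 2 * \<delta>2)) \<le> 4 * k2"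
      using k2 by (simp add: m_def w_def field_simps)
    \<comment> \<open>\<open>wb\<close> puts \<open>w\<close> below the positive root of
      \<open>\<delta>2 * w\<^sup>2 + \<delta>1 * w / (2 * k2) = 1\<close>, written with the square
      root in the denominator. Isolating the square root and squaring recovers the
      quadratic.\<close>
    have small: "\<delta>2 * w\<^sup>2 + \<delta>1 * w / (2 * k2) \<le> 1"
    proof -
      have "w * sqrt (\<delta>1\<^sup>2 + 16 * ln 2 * \<delta>2) \<le> 4 * k2 - \<delta>1 * w" using wb by (simp add: algebra_simps)
      then have "(w * sqrt (\<delta>1\<^sup>2 + 16 * ln 2 * \<delta>2))\<^sup>2 \<le> (4 * k2 - \<delta>1 * w)\<^sup>2"
        using w \<delta>1 \<delta>2 by (intro power_mono) auto
      then have "w\<^sup>2 * (\<delta>1\<^sup>2 + 16 * k2\<^sup>2 * \<delta>2) \<le> 16 * k2\<^sup>2 - 8 * k2 * \<delta>1 * w + (\<delta>1 * w)\<^sup>2"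
        using \<delta>1 \<delta>2 k2 by (simp add: power_mult_distrib power2_diff)
      then have "k2 * (16 * k2 * (\<delta>2 * w\<^sup>2) + 8 * (\<delta>1 * w)) \<le> k2 * (16 * k2)"
        by (simp add: algebra_simps power2_eq_square)
      then have "16 * k2 * (\<delta>2 * w\<^sup>2) + 8 * (\<delta>1 * w) \<le> 16 * k2" using k2 by simp
      then show ?thesis using k2 by (simp add: field_simps)
    qed
    have "renyi q (C.kernel ((Ptil G T h ^^ k) \<mu>)) (C.kernel \<nu>)
      \<le> ereal ((\<delta>1 * k2 * w + \<delta>2 * ln 2 * w\<^sup>2) / (q - 1))"
      using C.renyi_kernel_le[OF q \<rho> nu Ww] small unfolding k2_def \<delta>1_def \<delta>2_def d_def by simp
    \<comment> \<open>The kernel is applied once more to both laws; stationarity turns the second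
      back into \<nu>.\<close>
    then have "renyi q ((Ptil G T h ^^ (k + 1)) \<mu>) \<nu> \<le> ereal ((\<delta>1 * k2 * w + \<delta>2 * ln 2 * w\<^sup>2) / (q - 1))"
      using stationary by (simp add: Ptil)
    \<comment> \<open>The linear and the quadratic term are brought to one size by
      \<open>W \<le> max 1 (W\<^sup>2)\<close>, \<open>c1 \<le> c1\<^sup>2\<close>,
      \<open>\<epsilon>\<^sup>2 \<le> \<epsilon>\<close> and
      \<open>ln 2 \<le> sqrt (ln 2)\<close>.\<close>
    also have "\<dots> \<le> ereal ((\<delta>1 + \<delta>2) / (q - 1) * k2 * c1\<^sup>2 * \<epsilon> * max 1 (W\<^sup>2))"
    proof -
      define m1 where "m1 = max 1 (W\<^sup>2)"
      have "W \<le> m1"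
        using power_increasing[of 1 2 W] by (cases "W \<le> 1") (auto simp: m1_def max_def)
      moreover have "c1 \<le> c1\<^sup>2" using c1 power_increasing[of 1 2 c1] by simp
      ultimately have w1: "w \<le> c1\<^sup>2 * \<epsilon> * m1"
        unfolding w_def using c1 \<epsilon> W by (intro mult_mono) auto
      have "\<epsilon>\<^sup>2 \<le> \<epsilon>" using \<epsilon> by (simp add: power2_eq_square mult_left_le)
      then have w2: "w\<^sup>2 \<le> c1\<^sup>2 * \<epsilon> * m1"
        unfolding w_def power_mult_distrib m1_def using c1 \<epsilon> by (intro mult_mono) auto
      have "k2 \<le> 1" using ln_2_less_1 by (simp add: k2_def)
      then have ln2: "ln 2 \<le> k2" unfolding k2(2)[symmetric] using k2(1) by (simp add: power2_eq_square mult_left_le)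
      have "\<delta>1 * k2 * w + \<delta>2 * ln 2 * w\<^sup>2 \<le> \<delta>1 * k2 * (c1\<^sup>2 * \<epsilon> * m1) + \<delta>2 * k2 * (c1\<^sup>2 * \<epsilon> * m1)"
        using \<delta>1 \<delta>2 k2(1) w w1 w2 ln2 by (intro add_mono mult_mono) auto
      then have "(\<delta>1 * k2 * w + \<delta>2 * ln 2 * w\<^sup>2) / (q - 1) \<le> (\<delta>1 * k2 * (c1\<^sup>2 * \<epsilon> * m1) + \<delta>2 * k2 * (c1\<^sup>2 * \<epsilon> * m1)) / (q - 1)"
        using q by (intro divide_right_mono) auto
      also have "\<dots> = (\<delta>1 + \<delta>2) / (q - 1) * k2 * c1\<^sup>2 * \<epsilon> * m1"
        by (simp add: divide_inverse algebra_simps)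
      finally show ?thesis by (simp add: m1_def)
    qed
    also have "\<dots> = ereal ((\<delta>1 + \<delta>2) / (q - 1) * k2 * c1\<^sup>2 * exp (- c2 * real k)) * max 1 ((W_psi \<mu> \<nu>)\<^sup>2)"
    proof -
      have "max 1 ((W_psi \<mu> \<nu>)\<^sup>2) = ereal (max 1 (W\<^sup>2))"
        by (simp add: W ereal_max[symmetric] one_ereal_def power2_eq_square del: ereal_max)
      then show ?thesis unfolding \<epsilon>_def by (simp only: times_ereal.simps)
    qed
    finally show ?thesis .
  qed
  then show ?thesis
    unfolding Let_def m_def k2_def \<delta>1_def \<delta>2_def d_def by blast
qed

end
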